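(* Let $\alpha\in(0,1)$, let $Z$ be a one-dimensional rotationally invariant and symmetric $\alpha$-stable process, and for $x\in\mathbb{R}$ let $\mathbb{P}_x$ be the law of the Lévy process $X^x_t=x+Z_t+t$ on the canonical càdlàg path space, with coordinate process $X$ and expectation $\mathbb{E}_x$. Let $D:=(0,1)$ and $\tau_D:=\inf\{t\ge0:X_t\notin D\}$. Then $$(i)\ \inf_{x\in(0,1/4)}\mathbb{E}_x\tau_D>0;\qquad(ii)\ \sup_{x\in D}\mathbb{P}_x(X_{\tau_D}=0)=0;\qquad(iii)\ \sup_{x\in D}\mathbb{P}_x(X_{\tau_D}=1)>0.$$
   Context: The symmetric $\alpha$-stable process $Z$ on $\mathbb{R}$ starts from $0$ and has characteristic function $\mathbb{E}e^{i\xi Z_t}=e^{-t|\xi|^\alpha}$. *)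

theory Defs
  imports "HOL-Probability.Probability"
begin

text \<open>
  The time set is \<open>[0, \<infinity>)\<close>, encoded as \<open>{0..}\<close> inside \<^typ>\<open>real\<close>; values of paths and
  processes at negative times are irrelevant.
\<close>

definition cadlag :: "(real \<Rightarrow> real) \<Rightarrow> bool" where
  "cadlag f \<longleftrightarrow>
     (\<forall>t\<ge>0. continuous (at_right t) f) \<and> (\<forall>t>0. \<exists>l. (f \<longlongrightarrow> l) (at_left t))"

locale levy_process = prob_space M
  for M :: "'a measure" and Z :: "real \<Rightarrow> 'a \<Rightarrow> real" +
  assumes random_variable_Z: "t \<ge> 0 \<Longrightarrow> random_variable borel (Z t)"
    and cadlag_paths: "\<omega> \<in> space M \<Longrightarrow> cadlag (\<lambda>t. Z t \<omega>)"
    and start_zero: "AE \<omega> in M. Z 0 \<omega> = 0"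
    and indep_increments:
      "\<lbrakk>0 \<le> r 0; \<And>i. i < n \<Longrightarrow> r i \<le> r (Suc i)\<rbrakk> \<Longrightarrow>
         indep_vars (\<lambda>_. borel) (\<lambda>i \<omega>. Z (r (Suc i)) \<omega> - Z (r i) \<omega>) {..<n::nat}"
    and stationary_increments:
      "\<lbrakk>0 \<le> s; 0 \<le> t\<rbrakk> \<Longrightarrow>
         distr M borel (\<lambda>\<omega>. Z (s + t) \<omega> - Z s \<omega>) = distr M borel (\<lambda>\<omega>. Z t \<omega> - Z 0 \<omega>)"

locale symmetric_stable_process = levy_process M Z
  for M :: "'a measure" and \<alpha> :: real and Z :: "real \<Rightarrow> 'a \<Rightarrow> real" +
  assumes char_Z:
    "t \<ge> 0 \<Longrightarrow> char (distr M borel (Z t)) \<xi> = of_real (exp (- t * \<bar>\<xi>\<bar> powr \<alpha>))"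

text \<open>
  The canonical path space: cadlag functions on \<open>[0, \<infinity>)\<close> (represented extensionally),
  with the \<open>\<sigma>\<close>-algebra generated by the coordinate maps \<open>X\<^sub>t w = w t\<close>.
\<close>

definition path_space :: "(real \<Rightarrow> real) measure" where
  "path_space = restrict_space (PiM {0..} (\<lambda>_. borel)) {w. cadlag w}"

text \<open>
  The law of \<open>t \<mapsto> x + Z\<^sub>t + t\<close> on the path space. It is completed because exit times of
  cadlag paths from open sets (hitting times of closed sets) need not be measurable for the
  \<open>\<sigma>\<close>-algebra generated by the coordinates, but only for its completion.
\<close>

definition drift_law :: "'a measure \<Rightarrow> (real \<Rightarrow> 'a \<Rightarrow> real) \<Rightarrow> real \<Rightarrow> (real \<Rightarrow> real) measure" where
  "drift_law M Z x = completion (distr M path_space (\<lambda>\<omega>. \<lambda>t\<in>{0..}. x + Z t \<omega> + t))"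

text \<open>The infimum is taken in \<^typ>\<open>ennreal\<close>, so a path that never leaves \<open>D\<close> has exit time \<open>\<infinity>\<close>.\<close>

definition exit_time :: "real set \<Rightarrow> (real \<Rightarrow> real) \<Rightarrow> ennreal" where
  "exit_time D w = (INF t\<in>{t. 0 \<le> t \<and> w t \<notin> D}. ennreal t)"

text \<open>The event \<open>X\<^bsub>\<tau>\<^esub> = a\<close>, where \<open>\<tau>\<close> is the exit time from \<open>D\<close>; it includes \<open>\<tau> < \<infinity>\<close>.\<close>

definition exits_at :: "real set \<Rightarrow> real \<Rightarrow> (real \<Rightarrow> real) set" where
  "exits_at D a =
     {w \<in> space path_space. exit_time D w < \<infinity> \<and> w (enn2real (exit_time D w)) = a}"

end

theory Submission
  imports Defs
begin

text \<open>
  For \<open>\<alpha> < 1\<close> the process \<open>Z\<close> has paths of finite variation, and over short times its variation is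
  negligible against the unit drift. All three assertions are consequences of quantitative forms of
  these two facts, which come from the characteristic function alone and avoid the Levy-Ito
  decomposition. Gaussian smoothing turns the characteristic function into the tail bound
  \<open>P(\<bar>Z\<^sub>h\<bar> \<ge> y) \<le> C h y\<^bsup>-\<alpha>\<^esup>\<close> (\<open>stable_tail\<close>) and the small ball bound
  \<open>P(\<bar>Z\<^sub>t - u\<bar> \<le> y) \<le> K y\<close> for times \<open>t\<close> bounded away from \<open>0\<close> (\<open>stable_small_ball\<close>). Because
  \<open>\<alpha> < 1\<close>, the tail bound integrates to \<open>E min(\<bar>Z\<^sub>h\<bar>, r) \<le> C h r\<^bsup>1-\<alpha>\<^esup>\<close>. The right-hand side is linear
  in \<open>h\<close>, so it survives summation over a fine grid and bounds the truncated variation of \<open>Z\<close> on an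
  interval of length \<open>h\<close> in the same way (\<open>truncated_variation\<close>).

  (i) The variation bound with \<open>r\<close> proportional to \<open>h\<close> is summable over \<open>h = 1/2\<^sup>j\<close>. Hence with
  probability at least \<open>1/2\<close> the variation of \<open>Z\<close> on \<open>[0, 1/2\<^sup>j]\<close> is at most a quarter of the length
  of that interval for all \<open>j \<ge> J\<close> (\<open>ex_small_variation\<close>). On this event \<open>\<bar>Z\<^sub>t\<bar> \<le> t/2\<close> up to time
  \<open>T = 1/2\<^sup>J\<close>, so a path started at \<open>x < 1/4\<close> stays in \<open>[x, 3/4]\<close> before time \<open>T\<close>; neither \<open>T\<close> nor
  the event depends on \<open>x\<close> (\<open>exit_time_lower_bound\<close>).

  (ii) A path that leaves the interval at \<open>0\<close> either jumps onto \<open>0\<close> or reaches \<open>0\<close> continuously from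
  above. Both are excluded by counting grid cells of length \<open>1/2\<^sup>n\<close>. A cell with a jump of size more
  than \<open>\<eta>\<close> that lands within \<open>\<delta>\<close> of \<open>0\<close> has probability of order \<open>\<delta>/2\<^sup>n\<close>. If the path reaches \<open>0\<close>
  continuously, then the drift only lifts it, so in the cell of the hitting time the position at the
  left end lies between \<open>0\<close> and the variation of \<open>Z\<close> over the cell, and it is also at most \<open>\<delta>\<close>; this
  has probability of order \<open>\<delta>\<^bsup>1-\<alpha>\<^esup>/2\<^sup>n\<close>. Summing over the cells and letting \<open>\<delta>\<close> tend to \<open>0\<close> gives
  null events (\<open>AE_not_jump_near\<close>, \<open>AE_not_creep_down_near\<close>).

  (iii) On the event in (i) the path with drift climbs by at least \<open>3T/4\<close> during \<open>[0, T]\<close>, whereas the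
  levels that it can cross by an upward jump have Lebesgue measure at most twice the variation of
  \<open>Z\<close>, that is \<open>T/2\<close> (\<open>levels_jumped_over\<close>). By Fubini some level \<open>a < 3T/4\<close> is crossed continuously
  with positive probability, and starting from \<open>1 - a\<close> turns this level into the end point \<open>1\<close>.
  This also requires the exit event to be measurable for the completed law: outside the null set of
  paths with a jump from or onto \<open>0\<close> or \<open>1\<close> it agrees with the event \<open>approaches_one\<close>, which is
  determined by the values of the path at rational times.
\<close>

section \<open>Gaussian smoothing and one-dimensional estimates\<close>

text \<open>
  The Gaussian is, up to scaling, its own characteristic function, so this is Parseval's identity: write
  the Gaussian as an integral of exponentials and exchange the order of integration. With \<open>a\<close> as
  the centre and \<open>y\<close> as the width it serves both as a smooth indicator of \<open>[a - y, a + y]\<close> and,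
  subtracted from \<open>1\<close>, as a smooth indicator of the complement.
\<close>

lemma gaussian_smoothing:
  assumes "real_distribution \<mu>" and y: "0 < y"
  shows "(\<integral>z. exp (- (((z - a) / y)^2) / 2) \<partial>\<mu>) =
    Re (\<integral>\<xi>. iexp (- (\<xi> * a / y)) * char \<mu> (\<xi> / y) \<partial>std_normal_distribution)"
proof -
  interpret \<mu>: real_distribution \<mu> by fact
  interpret N: real_distribution std_normal_distribution by (rule real_dist_normal_dist)
  interpret P: pair_prob_space \<mu> std_normal_distribution ..
  let ?N = std_normal_distribution
  have int: "integrable (\<mu> \<Otimes>\<^sub>M ?N) (\<lambda>(z, \<xi>). iexp (((z - a) / y) * \<xi>))"
    by (intro P.integrable_const_bound[of _ 1]) (auto simp: norm_exp_i_times split_beta')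
  have "complex_of_real (\<integral>z. exp (- (((z - a) / y)^2) / 2) \<partial>\<mu>)
      = (\<integral>z. complex_of_real (exp (- (((z - a) / y)^2) / 2)) \<partial>\<mu>)"
    by (rule integral_complex_of_real[symmetric])
  also have "\<dots> = (\<integral>z. char ?N ((z - a) / y) \<partial>\<mu>)"
    by (simp only: char_std_normal_distribution)
  also have "\<dots> = (\<integral>z. \<integral>\<xi>. iexp (((z - a) / y) * \<xi>) \<partial>?N \<partial>\<mu>)"
    by (simp add: char_def)
  also have "\<dots> = (\<integral>\<xi>. \<integral>z. iexp (((z - a) / y) * \<xi>) \<partial>\<mu> \<partial>?N)"
    by (rule P.Fubini_integral[OF int, symmetric])
  also have "\<dots> = (\<integral>\<xi>. iexp (- (\<xi> * a / y)) * char \<mu> (\<xi> / y) \<partial>?N)"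
  proof (rule Bochner_Integration.integral_cong[OF refl])
    fix \<xi> :: real
    have "(\<integral>z. iexp (((z - a) / y) * \<xi>) \<partial>\<mu>) = (\<integral>z. iexp (- (\<xi> * a / y)) * iexp (\<xi> / y * z) \<partial>\<mu>)"
      by (intro Bochner_Integration.integral_cong[OF refl])
         (simp add: exp_add[symmetric] diff_divide_distrib algebra_simps)
    then show "(\<integral>z. iexp (((z - a) / y) * \<xi>) \<partial>\<mu>) = iexp (- (\<xi> * a / y)) * char \<mu> (\<xi> / y)"
      by (simp add: char_def)
  qed
  finally show ?thesis by (metis Re_complex_of_real)
qed

lemma lborel_integrable_inverse_1_plus_square: "integrable lborel (\<lambda>x::real. inverse (1 + x\<^sup>2))"
  using integrable_inverse_1_plus_square by (simp add: set_integrable_def)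

lemma exp_minus_le_inverse_power:
  fixes u :: real assumes "0 < u" shows "exp (- u) \<le> fact k / u ^ k"
proof -
  have "u ^ k / fact k \<le> exp u"
    using sum_le_suminf[OF summable_exp_generic[of u], of "{k}"] assms
    by (simp add: exp_def divide_inverse mult.commute)
  then show ?thesis using assms by (simp add: exp_minus field_simps)
qed

lemma integrable_exp_minus_abs_powr:
  fixes \<alpha> \<epsilon> :: real
  assumes a: "0 < \<alpha>" and e: "0 < \<epsilon>"
  shows "integrable lborel (\<lambda>\<xi>::real. exp (- \<epsilon> * \<bar>\<xi>\<bar> powr \<alpha>))"
proof -
  \<comment> \<open>The exponential decays faster than \<open>\<bar>\<xi>\<bar> powr (- \<alpha> * k)\<close>, and \<open>\<alpha> * k \<ge> 2\<close> makes this integrable.\<close>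
  obtain k :: nat where k: "2 / \<alpha> \<le> real k" using real_arch_simple by blast
  then have k2: "2 \<le> \<alpha> * k" using a by (simp add: field_simps)
  define B where "B = max 1 (fact k / \<epsilon> ^ k)"
  have B: "exp (- \<epsilon> * \<bar>\<xi>\<bar> powr \<alpha>) \<le> 2 * B * inverse (1 + \<xi>\<^sup>2)" for \<xi> :: real
  proof (cases "\<bar>\<xi>\<bar> \<le> 1")
    case True
    then have "\<xi>\<^sup>2 \<le> 1" by (simp add: abs_square_le_1)
    then have "1 \<le> 2 * inverse (1 + \<xi>\<^sup>2)" by (simp add: field_simps add_pos_nonneg)
    moreover have "1 \<le> B" by (simp add: B_def)
    ultimately have "1 * 1 \<le> B * (2 * inverse (1 + \<xi>\<^sup>2))"
      by (intro mult_mono) simp_all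
    moreover have "exp (- \<epsilon> * \<bar>\<xi>\<bar> powr \<alpha>) \<le> 1" using e by simp
    ultimately show ?thesis by linarith
  next
    case False
    then have x: "1 < \<bar>\<xi>\<bar>" by simp
    have "exp (- (\<epsilon> * \<bar>\<xi>\<bar> powr \<alpha>)) \<le> fact k / (\<epsilon> * \<bar>\<xi>\<bar> powr \<alpha>) ^ k"
      using x e by (intro exp_minus_le_inverse_power) auto
    also have "\<dots> = fact k / \<epsilon> ^ k / \<bar>\<xi>\<bar> powr (\<alpha> * k)"
      using x by (simp add: power_mult_distrib powr_power mult.commute)
    also have "\<dots> \<le> fact k / \<epsilon> ^ k / \<bar>\<xi>\<bar> powr 2"
      using x e k2 by (intro divide_left_mono powr_mono) auto
    also have "\<dots> = fact k / \<epsilon> ^ k * inverse (\<xi>\<^sup>2)"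
      using x by (simp add: divide_inverse)
    also have "\<dots> \<le> B * (2 * inverse (1 + \<xi>\<^sup>2))"
    proof (rule mult_mono)
      have "1 \<le> \<xi>\<^sup>2" using one_le_power[of "\<bar>\<xi>\<bar>" 2] x by (simp only: power2_abs less_imp_le)
      then have "(1 + \<xi>\<^sup>2) / 2 \<le> (\<xi>\<^sup>2 + \<xi>\<^sup>2) / 2" by (intro divide_right_mono add_right_mono) simp_all
      then have "(1 + \<xi>\<^sup>2) / 2 \<le> \<xi>\<^sup>2" by simp
      then have "inverse (\<xi>\<^sup>2) \<le> inverse ((1 + \<xi>\<^sup>2) / 2)"
        by (rule le_imp_inverse_le) (simp add: add_pos_nonneg)
      then show "inverse (\<xi>\<^sup>2) \<le> 2 * inverse (1 + \<xi>\<^sup>2)" unfolding inverse_divide by (simp only: divide_inverse)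
      show "fact k / \<epsilon> ^ k \<le> B" unfolding B_def by (rule max.cobounded2)
      then show "0 \<le> B" unfolding B_def by linarith
    qed simp
    finally show ?thesis by simp
  qed
  have "integrable lborel (\<lambda>\<xi>::real. 2 * B * inverse (1 + \<xi>\<^sup>2))"
    by (intro integrable_mult_right lborel_integrable_inverse_1_plus_square)
  then show ?thesis
  proof (rule Bochner_Integration.integrable_bound)
    have "norm (exp (- \<epsilon> * \<bar>\<xi>\<bar> powr \<alpha>)) \<le> norm (2 * B * inverse (1 + \<xi>\<^sup>2))" for \<xi> :: real
      using B[of \<xi>] unfolding real_norm_def abs_exp_cancel by linarith
    then show "AE \<xi> in lborel. norm (exp (- \<epsilon> * \<bar>\<xi>\<bar> powr \<alpha>)) \<le> norm (2 * B * inverse (1 + \<xi>\<^sup>2))"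
      by (rule AE_I2)
  qed simp
qed

text \<open>
  A multiple of the Gaussian of width \<open>y\<close> dominates the indicator of the ball. Its mean is an integral
  of the rescaled characteristic function \<open>\<xi> \<mapsto> char \<mu> (\<xi> / y)\<close> against a bounded density, and
  undoing the scaling produces the factor \<open>y\<close>. In effect the law has a bounded density, with a
  bound that is uniform in \<open>t \<ge> \<epsilon>\<close>; hence the order of the quantifiers.
\<close>

lemma stable_small_ball:
  fixes \<alpha> \<epsilon> :: real
  assumes a: "0 < \<alpha>" and e: "0 < \<epsilon>"
  shows "\<exists>K\<ge>0. \<forall>\<mu> t. real_distribution \<mu> \<longrightarrow> \<epsilon> \<le> t \<longrightarrow>
    (\<forall>\<xi>. char \<mu> \<xi> = of_real (exp (- t * \<bar>\<xi>\<bar> powr \<alpha>))) \<longrightarrow>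
    (\<forall>u y. 0 \<le> y \<longrightarrow> measure \<mu> {z. \<bar>z - u\<bar> \<le> y} \<le> K * y)"
proof (intro exI conjI allI impI)
  let ?I = "\<integral>\<xi>. exp (- \<epsilon> * \<bar>\<xi>\<bar> powr \<alpha>) \<partial>lborel"
  let ?N = std_normal_distribution
  show K0: "0 \<le> exp (1/2) * ?I" by simp
  fix \<mu> t u and y :: real
  assume mu: "real_distribution \<mu>" and t: "\<epsilon> \<le> t"
    and ch: "\<forall>\<xi>. char \<mu> \<xi> = of_real (exp (- t * \<bar>\<xi>\<bar> powr \<alpha>))" and y0: "0 \<le> y"
  interpret \<mu>: real_distribution \<mu> by fact
  interpret N: real_distribution ?N by (rule real_dist_normal_dist)
  have main: "measure \<mu> {z. \<bar>z - u\<bar> \<le> y} \<le> exp (1/2) * ?I * y" if y: "0 < y" for y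
  proof -
    have gint: "integrable \<mu> (\<lambda>z. exp (- (((z - u) / y)^2) / 2))"
      by (intro \<mu>.integrable_const_bound[of _ 1]) auto
    have "measure \<mu> {z. \<bar>z - u\<bar> \<le> y} = (\<integral>z. indicator {z. \<bar>z - u\<bar> \<le> y} z \<partial>\<mu>)"
      by simp
    also have "\<dots> \<le> (\<integral>z. exp (1/2) * exp (- (((z - u) / y)^2) / 2) \<partial>\<mu>)"
    proof (intro integral_mono integrable_mult_right gint)
      show "integrable \<mu> (indicator {z. \<bar>z - u\<bar> \<le> y} :: real \<Rightarrow> real)" by (simp add: \<mu>.emeasure_eq_measure)
      fix z show "indicator {z. \<bar>z - u\<bar> \<le> y} z \<le> exp (1/2) * exp (- (((z - u) / y)^2) / 2)"
      proof (cases "\<bar>z - u\<bar> \<le> y")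
        case True
        then have "((z - u) / y)^2 \<le> 1" using y by (simp add: abs_square_le_1 abs_divide)
        then show ?thesis by (simp add: exp_add[symmetric] True)
      qed (simp add: less_imp_le)
    qed
    also have "\<dots> = exp (1/2) * Re (\<integral>\<xi>. iexp (- (\<xi> * u / y)) * char \<mu> (\<xi> / y) \<partial>?N)"
      by (simp only: gaussian_smoothing[OF mu y, symmetric] integral_mult_right_zero)
    also have "Re (\<integral>\<xi>. iexp (- (\<xi> * u / y)) * char \<mu> (\<xi> / y) \<partial>?N)
       \<le> cmod (\<integral>\<xi>. iexp (- (\<xi> * u / y)) * char \<mu> (\<xi> / y) \<partial>?N)" by (rule complex_Re_le_cmod)
    also have "\<dots> \<le> (\<integral>\<xi>. cmod (iexp (- (\<xi> * u / y)) * char \<mu> (\<xi> / y)) \<partial>?N)"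
      by (rule integral_norm_bound)
    also have "\<dots> = (\<integral>\<xi>. exp (- t * \<bar>\<xi> / y\<bar> powr \<alpha>) \<partial>?N)"
      by (rule Bochner_Integration.integral_cong[OF refl])
         (simp add: ch norm_mult norm_exp_i_times[of "- _", simplified])
    also have "\<dots> = (\<integral>\<xi>. std_normal_density \<xi> * exp (- t * \<bar>\<xi> / y\<bar> powr \<alpha>) \<partial>lborel)"
      by (subst integral_density) auto
    also have "\<dots> \<le> (\<integral>\<xi>. exp (- \<epsilon> * \<bar>\<xi> / y\<bar> powr \<alpha>) \<partial>lborel)"
    proof (rule integral_mono')
      show "integrable lborel (\<lambda>\<xi>. exp (- \<epsilon> * \<bar>\<xi> / y\<bar> powr \<alpha>))"
        using lborel_integrable_real_affine[OF integrable_exp_minus_abs_powr[OF a e], of "1/y" 0] y by simp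
      fix \<xi> :: real
      have "std_normal_density \<xi> \<le> 1"
      proof -
        have "1 \<le> sqrt (2 * pi)" using pi_gt3 by (simp add: real_le_rsqrt)
        moreover have "exp (- \<xi>\<^sup>2 / 2) \<le> 1" by simp
        ultimately have "1 / sqrt (2*pi) * exp (- \<xi>\<^sup>2 / 2) \<le> 1 * 1" by (intro mult_mono) auto
        then show ?thesis by (simp add: std_normal_density_def)
      qed
      moreover have "exp (- t * \<bar>\<xi> / y\<bar> powr \<alpha>) \<le> exp (- \<epsilon> * \<bar>\<xi> / y\<bar> powr \<alpha>)"
        using t by (simp add: mult_right_mono)
      ultimately have "std_normal_density \<xi> * exp (- t * \<bar>\<xi> / y\<bar> powr \<alpha>) \<le> 1 * exp (- \<epsilon> * \<bar>\<xi> / y\<bar> powr \<alpha>)"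
        by (intro mult_mono) auto
      then show "std_normal_density \<xi> * exp (- t * \<bar>\<xi> / y\<bar> powr \<alpha>) \<le> exp (- \<epsilon> * \<bar>\<xi> / y\<bar> powr \<alpha>)" by simp
    qed auto
    also have "\<dots> = y * ?I"
      using lborel_integral_real_affine[of "1/y" "\<lambda>\<xi>. exp (- \<epsilon> * \<bar>\<xi>\<bar> powr \<alpha>)" 0] y by simp
    finally show ?thesis by (simp add: mult_ac)
  qed
  show "measure \<mu> {z. \<bar>z - u\<bar> \<le> y} \<le> exp (1/2) * ?I * y"
  proof (rule field_le_epsilon)
    fix e :: real assume e: "0 < e"
    let ?C = "exp (1/2) * ?I"
    define d where "d = e / (?C + 1)"
    have d: "0 < d" "?C * d \<le> e"
    proof -
      have C: "0 < ?C + 1" using K0 by linarith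
      then show "0 < d" using e by (simp only: d_def divide_pos_pos)
      have "?C * d \<le> (?C + 1) * d" using \<open>0 < d\<close> by (intro mult_right_mono) auto
      also have "\<dots> = e" using C by (simp only: d_def) simp
      finally show "?C * d \<le> e" .
    qed
    have "measure \<mu> {z. \<bar>z - u\<bar> \<le> y} \<le> measure \<mu> {z. \<bar>z - u\<bar> \<le> y + d}"
      using d by (intro \<mu>.finite_measure_mono) auto
    also have "\<dots> \<le> ?C * (y + d)" using main[of "y + d"] d y0 by simp
    also have "\<dots> \<le> ?C * y + e" using d by (simp add: distrib_left)
    finally show "measure \<mu> {z. \<bar>z - u\<bar> \<le> y} \<le> ?C * y + e" .
  qed
qed

text \<open>
  One minus the Gaussian of width \<open>y\<close> is at least \<open>1 - exp (- 1/2)\<close> outside \<open>[- y, y]\<close>. Its mean is the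
  Gaussian average of \<open>1 - exp (- h * \<bar>\<xi> / y\<bar> powr \<alpha>) \<le> h * \<bar>\<xi> / y\<bar> powr \<alpha>\<close>, and
  \<open>\<bar>\<xi>\<bar> powr \<alpha> \<le> 1 + \<xi>\<^sup>2\<close> has Gaussian mean at most \<open>2\<close>.
\<close>

lemma stable_tail:
  fixes \<alpha> :: real
  assumes al: "0 < \<alpha>" "\<alpha> \<le> 2" and "real_distribution \<mu>" and h: "0 \<le> h" and y: "0 < y"
    and ch: "\<And>\<xi>. char \<mu> \<xi> = of_real (exp (- h * \<bar>\<xi>\<bar> powr \<alpha>))"
  shows "measure \<mu> {z. y \<le> \<bar>z\<bar>} \<le> 2 / (1 - exp (- (1/2))) * h * y powr - \<alpha>"
proof -
  interpret \<mu>: real_distribution \<mu> by fact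
  let ?N = std_normal_distribution
  interpret N: real_distribution ?N by (rule real_dist_normal_dist)
  let ?c = "1 - exp (- (1/2)) :: real"
  have c: "0 < ?c" by simp
  have gint: "integrable \<mu> (\<lambda>z. exp (- ((z / y)^2) / 2))"
    by (intro \<mu>.integrable_const_bound[of _ 1]) auto
  have cint: "integrable ?N (\<lambda>\<xi>. exp (- h * \<bar>\<xi> / y\<bar> powr \<alpha>))"
    using h by (intro N.integrable_const_bound[of _ 1]) auto
  have "?c * measure \<mu> {z. y \<le> \<bar>z\<bar>} = (\<integral>z. ?c * indicator {z. y \<le> \<bar>z\<bar>} z \<partial>\<mu>)"
    by simp
  also have "\<dots> \<le> (\<integral>z. 1 - exp (- ((z / y)^2) / 2) \<partial>\<mu>)"
  proof (intro integral_mono integrable_mult_right Bochner_Integration.integrable_diff gint)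
    show "integrable \<mu> (indicator {z. y \<le> \<bar>z\<bar>} :: real \<Rightarrow> real)" by (simp add: \<mu>.emeasure_eq_measure)
    fix z show "?c * indicator {z. y \<le> \<bar>z\<bar>} z \<le> 1 - exp (- ((z / y)^2) / 2)"
    proof (cases "y \<le> \<bar>z\<bar>")
      case True
      then have "1 \<le> \<bar>z / y\<bar>" using y by simp
      from one_le_power[OF this, of 2] have "1 \<le> (z / y)^2" by (simp only: power2_abs)
      then show ?thesis by (simp add: True)
    qed simp
  qed simp
  also have "\<dots> = 1 - (\<integral>z. exp (- (((z - 0) / y)^2) / 2) \<partial>\<mu>)"
    by (subst Bochner_Integration.integral_diff) (use gint \<mu>.prob_space in auto)
  also have "\<dots> = 1 - Re (\<integral>\<xi>. complex_of_real (exp (- h * \<bar>\<xi> / y\<bar> powr \<alpha>)) \<partial>?N)"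
    by (subst gaussian_smoothing[OF assms(3) y]) (simp add: ch)
  also have "\<dots> = 1 - (\<integral>\<xi>. exp (- h * \<bar>\<xi> / y\<bar> powr \<alpha>) \<partial>?N)"
    by (subst integral_complex_of_real) simp
  also have "\<dots> = (\<integral>\<xi>. 1 - exp (- h * \<bar>\<xi> / y\<bar> powr \<alpha>) \<partial>?N)"
    by (subst Bochner_Integration.integral_diff) (use cint N.prob_space in auto)
  also have "\<dots> \<le> (\<integral>\<xi>. h * y powr - \<alpha> * (1 + \<xi>^2) \<partial>?N)"
  proof (intro integral_mono)
    show "integrable ?N (\<lambda>\<xi>. 1 - exp (- h * \<bar>\<xi> / y\<bar> powr \<alpha>))" using cint by auto
    show "integrable ?N (\<lambda>\<xi>. h * y powr - \<alpha> * (1 + \<xi>^2))"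
      using integrable_std_normal_distribution_moment[of 2] by auto
    fix \<xi> :: real
    have "1 - exp (- h * \<bar>\<xi> / y\<bar> powr \<alpha>) \<le> h * \<bar>\<xi> / y\<bar> powr \<alpha>"
      using exp_ge_add_one_self[of "- h * \<bar>\<xi> / y\<bar> powr \<alpha>"] by linarith
    also have "\<dots> = h * y powr - \<alpha> * \<bar>\<xi>\<bar> powr \<alpha>"
      using y by (simp add: abs_divide powr_divide powr_minus_divide)
    also have "\<bar>\<xi>\<bar> powr \<alpha> \<le> 1 + \<xi>^2"
    proof (cases "\<bar>\<xi>\<bar> \<le> 1")
      case True
      then have "\<bar>\<xi>\<bar> powr \<alpha> \<le> 1" using al by (intro powr_le1) auto
      then show ?thesis by (smt (verit) zero_le_power2)
    next
      case False
      then have "\<bar>\<xi>\<bar> powr \<alpha> \<le> \<bar>\<xi>\<bar> powr 2" using al by (intro powr_mono) auto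
      then show ?thesis using False by simp
    qed
    finally show "1 - exp (- h * \<bar>\<xi> / y\<bar> powr \<alpha>) \<le> h * y powr - \<alpha> * (1 + \<xi>^2)"
      using h by (simp add: mult_left_mono)
  qed
  also have "\<dots> = h * y powr - \<alpha> * (1 + 1)"
    using std_normal_distribution_even_moments[of 1] N.prob_space
    by (subst integral_mult_right_zero, subst Bochner_Integration.integral_add) auto
  finally show ?thesis using c by (simp add: field_simps)
qed

section \<open>Truncated variation of the stable process\<close>

locale small_index_stable_process = symmetric_stable_process +
  assumes alpha_pos: "0 < \<alpha>" and alpha_less_1: "\<alpha> < 1"

text \<open>
  Variation of \<open>f\<close> on \<open>[s, s + h]\<close> along the partition into \<open>2 ^ m\<close> equal parts. It increases with
  \<open>m\<close>, and for right continuous \<open>f\<close> the supremum over \<open>m\<close> controls every increment of \<open>f\<close> on the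
  interval. Only countably many time points are involved, which keeps everything measurable.
\<close>

definition dyadic_variation :: "nat \<Rightarrow> real \<Rightarrow> real \<Rightarrow> (real \<Rightarrow> real) \<Rightarrow> real" where
  "dyadic_variation m s h f =
     (\<Sum>i<2^m. \<bar>f (s + real (Suc i) * h / 2^m) - f (s + real i * h / 2^m)\<bar>)"

lemma dyadic_variation_nonneg: "0 \<le> dyadic_variation m s h f"
  by (simp add: dyadic_variation_def sum_nonneg)

lemma dyadic_variation_Suc: "dyadic_variation m s h f \<le> dyadic_variation (Suc m) s h f"
proof -
  let ?d = "\<lambda>i. \<bar>f (s + real (Suc i) * h / 2^Suc m) - f (s + real i * h / 2^Suc m)\<bar>"
  have "dyadic_variation m s h f \<le> (\<Sum>i<2^m. sum ?d {i * 2..<i * 2 + 2})"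
    unfolding dyadic_variation_def
  proof (intro sum_mono)
    fix i :: nat
    have "{i * 2..<i * 2 + 2} = {i * 2, Suc (i * 2)}" by auto
    then have eq: "sum ?d {i * 2..<i * 2 + 2} = ?d (i * 2) + ?d (Suc (i * 2))" by simp
    have "s + real (Suc (Suc (i * 2))) * h / 2 ^ Suc m = s + real (Suc i) * h / 2^m"
      "s + real (i * 2) * h / 2 ^ Suc m = s + real i * h / 2^m"
      by (simp_all add: field_simps)
    then show "\<bar>f (s + real (Suc i) * h / 2^m) - f (s + real i * h / 2^m)\<bar> \<le> sum ?d {i * 2..<i * 2 + 2}"
      unfolding eq by (simp only:)
  qed
  also have "\<dots> = dyadic_variation (Suc m) s h f"
    unfolding dyadic_variation_def by (subst sum.nat_group) (simp add: mult.commute)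
  finally show ?thesis .
qed

lemma dyadic_variation_mono: "m \<le> n \<Longrightarrow> dyadic_variation m s h f \<le> dyadic_variation n s h f"
  by (rule lift_Suc_mono_le[of "\<lambda>m. dyadic_variation m s h f"]) (rule dyadic_variation_Suc)

lemma min_sum_le_sum_min:
  fixes a :: "'i \<Rightarrow> real"
  assumes "finite I" "\<And>i. i \<in> I \<Longrightarrow> 0 \<le> a i" "0 \<le> r"
  shows "min (sum a I) r \<le> (\<Sum>i\<in>I. min (a i) r)"
  using assms
proof (induction I)
  case (insert i I)
  then have "min (sum a I) r \<le> (\<Sum>i\<in>I. min (a i) r)" "0 \<le> sum a I" "0 \<le> a i"
    by (auto intro: sum_nonneg)
  then show ?case using insert.hyps \<open>0 \<le> r\<close> by (auto simp: min_def split: if_splits)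
qed simp

text \<open>
  A layer cake decomposition along the levels \<open>r / 2 ^ j\<close>: a tail bound of order \<open>y powr - \<alpha>\<close> with
  \<open>\<alpha> < 1\<close> makes the means of the layers a geometric series.
\<close>

lemma min_le_dyadic_layers:
  fixes a r :: real
  assumes "0 \<le> a" "0 < r"
  shows "ennreal (min a r) \<le> (\<Sum>j. ennreal (r / 2^j) * indicator {u. r / 2^Suc j \<le> u} a)"
proof (cases "a = 0")
  case False
  with assms have a: "0 < a" by simp
  have "\<exists>j. r / 2^Suc j \<le> a"
  proof -
    obtain j where "(1/2)^j < a / r" using real_arch_pow_inv[of "a / r" "1/2"] a assms by auto
    then have "r / 2^j < a" using assms by (simp add: field_simps)
    moreover have "r / 2 ^ Suc j \<le> r / 2^j" using assms by (simp add: field_simps)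
    ultimately show ?thesis by (meson less_eq_real_def order_trans)
  qed
  define j where "j = (LEAST j. r / 2^Suc j \<le> a)"
  have j: "r / 2^Suc j \<le> a"
    unfolding j_def by (rule LeastI_ex) fact
  have "min a r \<le> r / 2^j"
  proof (cases j)
    case (Suc k)
    then have "\<not> r / 2^Suc k \<le> a" using not_less_Least[of k "\<lambda>j. r / 2^Suc j \<le> a"] j_def by simp
    then show ?thesis using Suc by simp
  qed simp
  then have "ennreal (min a r) \<le> ennreal (r / 2^j) * indicator {u. r / 2^Suc j \<le> u} a"
    using j by (simp add: ennreal_leI)
  also have "\<dots> = (\<Sum>i\<in>{j}. ennreal (r / 2^i) * indicator {u. r / 2^Suc i \<le> u} a)"
    by (subst sum.insert) (simp_all del: power_Suc)
  also have "\<dots> \<le> (\<Sum>j. ennreal (r / 2^j) * indicator {u. r / 2^Suc j \<le> u} a)"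
    by (intro sum_le_suminf) auto
  finally show ?thesis .
qed (use assms in simp)

context small_index_stable_process
begin

lemma Z_measurable [measurable]: "0 \<le> t \<Longrightarrow> Z t \<in> borel_measurable M"
  by (rule random_variable_Z)

lemma increment_distr:
  assumes "0 \<le> s" "0 \<le> h"
  shows "distr M borel (\<lambda>\<omega>. Z (s + h) \<omega> - Z s \<omega>) = distr M borel (Z h)"
proof -
  have "distr M borel (\<lambda>\<omega>. Z (s + h) \<omega> - Z s \<omega>) = distr M borel (\<lambda>\<omega>. Z h \<omega> - Z 0 \<omega>)"
    by (rule stationary_increments[OF assms])
  also have "\<dots> = distr M borel (Z h)"
    using start_zero assms by (intro distr_cong_AE) auto
  finally show ?thesis .
qed

lemma increment_tail:
  assumes "0 \<le> s" "0 \<le> h" "0 < y"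
  shows "prob {\<omega> \<in> space M. y \<le> \<bar>Z (s + h) \<omega> - Z s \<omega>\<bar>}
    \<le> 2 / (1 - exp (- (1/2))) * h * y powr - \<alpha>"
proof -
  have "prob {\<omega> \<in> space M. y \<le> \<bar>Z (s + h) \<omega> - Z s \<omega>\<bar>}
     = measure (distr M borel (\<lambda>\<omega>. Z (s + h) \<omega> - Z s \<omega>)) {z. y \<le> \<bar>z\<bar>}"
    using assms by (subst measure_distr) (auto simp: vimage_def Int_def conj_commute)
  also have "\<dots> = measure (distr M borel (Z h)) {z. y \<le> \<bar>z\<bar>}"
    by (simp add: increment_distr assms)
  also have "\<dots> \<le> 2 / (1 - exp (- (1/2))) * h * y powr - \<alpha>"
    using assms alpha_pos alpha_less_1 char_Z by (intro stable_tail) auto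
  finally show ?thesis .
qed

text \<open>
  The constant of the tail bound times the sum of the geometric series over the dyadic layers; that
  series converges because \<open>\<alpha> < 1\<close>.
\<close>

definition increment_const :: real where
  "increment_const = 2 / (1 - exp (- (1/2))) * 2 powr \<alpha> / (1 - 2 powr (\<alpha> - 1))"

lemma increment_const_nonneg: "0 \<le> increment_const"
proof -
  have "2 powr (\<alpha> - 1) \<le> 2 powr (0::real)" using alpha_less_1 by (intro powr_mono) auto
  then show ?thesis unfolding increment_const_def
    by (intro divide_nonneg_nonneg mult_nonneg_nonneg) auto
qed

lemma truncated_increment:
  assumes s: "0 \<le> s" and h: "0 \<le> h" and r: "0 < r"
  shows "(\<integral>\<^sup>+\<omega>. ennreal (min \<bar>Z (s + h) \<omega> - Z s \<omega>\<bar> r) \<partial>M)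
    \<le> ennreal (increment_const * h * r powr (1 - \<alpha>))"
proof -
  let ?D = "\<lambda>\<omega>. \<bar>Z (s + h) \<omega> - Z s \<omega>\<bar>"
  let ?c = "2 / (1 - exp (- (1/2))) :: real"
  let ?q = "2 powr (\<alpha> - 1)"
  have [measurable]: "?D \<in> borel_measurable M" using s h by simp
  have q: "0 < ?q" "?q < 1" using alpha_less_1 powr_less_mono[of "\<alpha> - 1" 0 2] by auto
  have c: "0 \<le> ?c" by simp
  have "(\<integral>\<^sup>+\<omega>. ennreal (min (?D \<omega>) r) \<partial>M)
      \<le> (\<integral>\<^sup>+\<omega>. (\<Sum>j. ennreal (r / 2^j) * indicator {u. r / 2^Suc j \<le> u} (?D \<omega>)) \<partial>M)"
    by (intro nn_integral_mono min_le_dyadic_layers) (use r in auto)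
  also have "\<dots> = (\<Sum>j. \<integral>\<^sup>+\<omega>. ennreal (r / 2^j) * indicator {u. r / 2^Suc j \<le> u} (?D \<omega>) \<partial>M)"
    by (subst nn_integral_suminf) auto
  also have "\<dots> = (\<Sum>j. ennreal (r / 2^j) * emeasure M {\<omega> \<in> space M. r / 2^Suc j \<le> ?D \<omega>})"
  proof (intro suminf_cong)
    fix j
    have "(\<integral>\<^sup>+\<omega>. ennreal (r / 2^j) * indicator {u. r / 2^Suc j \<le> u} (?D \<omega>) \<partial>M)
      = (\<integral>\<^sup>+\<omega>. ennreal (r / 2^j) * indicator {\<omega> \<in> space M. r / 2^Suc j \<le> ?D \<omega>} \<omega> \<partial>M)"
      by (intro nn_integral_cong) (auto simp: indicator_def)
    then show "(\<integral>\<^sup>+\<omega>. ennreal (r / 2^j) * indicator {u. r / 2^Suc j \<le> u} (?D \<omega>) \<partial>M)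
      = ennreal (r / 2^j) * emeasure M {\<omega> \<in> space M. r / 2^Suc j \<le> ?D \<omega>}"
      by (simp add: nn_integral_cmult_indicator)
  qed
  also have "\<dots> \<le> (\<Sum>j. ennreal (?c * 2 powr \<alpha> * h * r powr (1 - \<alpha>) * ?q ^ j))"
  proof (intro suminf_le)
    fix j :: nat
    have "ennreal (r / 2^j) * emeasure M {\<omega> \<in> space M. r / 2^Suc j \<le> ?D \<omega>}
      \<le> ennreal (r / 2^j) * ennreal (?c * h * (r / 2^Suc j) powr - \<alpha>)"
      unfolding emeasure_eq_measure
      using increment_tail[OF s h, of "r / 2^Suc j"] r by (intro mult_left_mono ennreal_leI) auto
    also have "\<dots> = ennreal (r / 2^j * (?c * h * (r / 2^Suc j) powr - \<alpha>))"
      using r c h by (subst ennreal_mult) auto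
    also have "r / 2^j * (?c * h * (r / 2^Suc j) powr - \<alpha>) = ?c * 2 powr \<alpha> * h * r powr (1 - \<alpha>) * ?q ^ j"
    proof -
      have "(r / 2^Suc j) powr - \<alpha> = (r / 2^j) powr - \<alpha> * 2 powr \<alpha>"
        using r by (simp add: powr_divide powr_mult powr_minus field_simps)
      moreover have "r / 2^j * (r / 2^j) powr - \<alpha> = (r / 2^j) powr (1 - \<alpha>)"
        using r powr_add[of "r/2^j" 1 "-\<alpha>"] by simp
      moreover have "(r / 2^j) powr (1 - \<alpha>) = r powr (1 - \<alpha>) * ?q ^ j"
      proof -
        have "?q ^ j = (2^j) powr (\<alpha> - 1)" by (simp add: powr_realpow[symmetric] powr_powr mult.commute)
        also have "\<dots> = 1 / (2^j) powr (1 - \<alpha>)" using powr_minus_divide[of "2^j" "1 - \<alpha>"] by simp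
        finally show ?thesis using r by (simp add: powr_divide)
      qed
      moreover have "r / 2^j * (?c * h * (A * 2 powr \<alpha>)) = ?c * 2 powr \<alpha> * h * (r / 2^j * A)" for A
        by (simp only: mult_ac)
      ultimately show ?thesis by (simp only: mult.assoc)
    qed
    finally show "ennreal (r / 2^j) * emeasure M {\<omega> \<in> space M. r / 2^Suc j \<le> ?D \<omega>}
      \<le> ennreal (?c * 2 powr \<alpha> * h * r powr (1 - \<alpha>) * ?q ^ j)" .
  qed auto
  also have "\<dots> = ennreal (?c * 2 powr \<alpha> * h * r powr (1 - \<alpha>) * (1 / (1 - ?q)))"
  proof (rule suminf_ennreal_eq)
    show "0 \<le> ?c * 2 powr \<alpha> * h * r powr (1 - \<alpha>) * ?q ^ j" for j
      using c h q by (intro mult_nonneg_nonneg) auto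
    show "(\<lambda>j. ?c * 2 powr \<alpha> * h * r powr (1 - \<alpha>) * ?q ^ j) sums
       (?c * 2 powr \<alpha> * h * r powr (1 - \<alpha>) * (1 / (1 - ?q)))"
      using q by (intro sums_mult geometric_sums) auto
  qed
  also have "?c * 2 powr \<alpha> * h * r powr (1 - \<alpha>) * (1 / (1 - ?q)) = increment_const * h * r powr (1 - \<alpha>)"
    by (simp add: increment_const_def)
  finally show ?thesis .
qed

lemma dyadic_variation_measurable [measurable]:
  assumes "0 \<le> s" "0 \<le> h"
  shows "(\<lambda>\<omega>. dyadic_variation m s h (\<lambda>t. Z t \<omega>)) \<in> borel_measurable M"
  unfolding dyadic_variation_def using assms
  by (intro borel_measurable_sum borel_measurable_abs borel_measurable_diff random_variable_Z) auto

text \<open>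
  Truncation is subadditive, so the means of the truncated increments add up, and since each of them is
  linear in the length of its grid cell the sum does not depend on the grid. This is the
  quantitative form of the finite variation of \<open>Z\<close>.
\<close>

lemma truncated_variation:
  assumes s: "0 \<le> s" and h: "0 \<le> h" and r: "0 < r"
  shows "(\<integral>\<^sup>+\<omega>. ennreal (min (dyadic_variation m s h (\<lambda>t. Z t \<omega>)) r) \<partial>M)
    \<le> ennreal (increment_const * h * r powr (1 - \<alpha>))"
proof -
  let ?D = "\<lambda>i \<omega>. \<bar>Z (s + real (Suc i) * h / 2^m) \<omega> - Z (s + real i * h / 2^m) \<omega>\<bar>"
  have [measurable]: "?D i \<in> borel_measurable M" for i
    using s h by (intro borel_measurable_abs borel_measurable_diff random_variable_Z) auto
  have "(\<integral>\<^sup>+\<omega>. ennreal (min (dyadic_variation m s h (\<lambda>t. Z t \<omega>)) r) \<partial>M)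
    \<le> (\<integral>\<^sup>+\<omega>. (\<Sum>i<2^m. ennreal (min (?D i \<omega>) r)) \<partial>M)"
  proof (intro nn_integral_mono)
    fix \<omega>
    have "min (dyadic_variation m s h (\<lambda>t. Z t \<omega>)) r \<le> (\<Sum>i<2^m. min (?D i \<omega>) r)"
      unfolding dyadic_variation_def using r by (intro min_sum_le_sum_min) auto
    then show "ennreal (min (dyadic_variation m s h (\<lambda>t. Z t \<omega>)) r) \<le> (\<Sum>i<2^m. ennreal (min (?D i \<omega>) r))"
      using r by (subst sum_ennreal) (auto intro: ennreal_leI)
  qed
  also have "\<dots> = (\<Sum>i<2^m. \<integral>\<^sup>+\<omega>. ennreal (min (?D i \<omega>) r) \<partial>M)"
    by (intro nn_integral_sum) measurable
  also have "\<dots> \<le> (\<Sum>i<(2::nat)^m. ennreal (increment_const * (h / 2^m) * r powr (1 - \<alpha>)))"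
  proof (intro sum_mono)
    fix i :: nat
    have "s + real (Suc i) * h / 2^m = (s + real i * h / 2^m) + h / 2^m" by (simp add: field_simps)
    then show "(\<integral>\<^sup>+\<omega>. ennreal (min (?D i \<omega>) r) \<partial>M) \<le> ennreal (increment_const * (h / 2^m) * r powr (1 - \<alpha>))"
      by (simp only:) (rule truncated_increment; use s h r in simp)
  qed
  also have "\<dots> = ennreal (increment_const * h * r powr (1 - \<alpha>))"
    using increment_const_nonneg h by (simp add: ennreal_of_nat_eq_real_of_nat ennreal_mult[symmetric])
  finally show ?thesis .
qed

lemma variation_tail:
  assumes s: "0 \<le> s" and h: "0 \<le> h" and r: "0 < r"
  shows "prob {\<omega> \<in> space M. r \<le> dyadic_variation m s h (\<lambda>t. Z t \<omega>)}
    \<le> increment_const * h * r powr - \<alpha>"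
proof -
  let ?V = "\<lambda>\<omega>. dyadic_variation m s h (\<lambda>t. Z t \<omega>)"
  have [measurable]: "?V \<in> borel_measurable M" using s h by measurable
  have "ennreal r * emeasure M {\<omega> \<in> space M. r \<le> ?V \<omega>}
      = (\<integral>\<^sup>+\<omega>. ennreal r * indicator {\<omega> \<in> space M. r \<le> ?V \<omega>} \<omega> \<partial>M)"
    by (simp add: nn_integral_cmult_indicator)
  also have "\<dots> \<le> (\<integral>\<^sup>+\<omega>. ennreal (min (?V \<omega>) r) \<partial>M)"
    by (intro nn_integral_mono) (auto simp: indicator_def intro: ennreal_leI)
  also have "\<dots> \<le> ennreal (increment_const * h * r powr (1 - \<alpha>))"
    by (rule truncated_variation[OF s h r])
  also have "increment_const * h * r powr (1 - \<alpha>) = r * (increment_const * h * r powr - \<alpha>)"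
    using r powr_add[of r 1 "- \<alpha>"] by simp
  finally have "ennreal (r * prob {\<omega> \<in> space M. r \<le> ?V \<omega>}) \<le> ennreal (r * (increment_const * h * r powr - \<alpha>))"
    using r by (simp add: emeasure_eq_measure ennreal_mult)
  then have "r * prob {\<omega> \<in> space M. r \<le> ?V \<omega>} \<le> r * (increment_const * h * r powr - \<alpha>)"
    using r h increment_const_nonneg by (subst (asm) ennreal_le_iff) auto
  then show ?thesis using r by simp
qed

end

section \<open>Independence and null events along dyadic grids\<close>

text \<open>
  Freeze the independent variable \<open>W\<close>, apply the small ball bound to the other one with the now constant
  centre and radius, and integrate the radius (Fubini). Both variables take values in the same type
  because independence of two variables is formulated for a common type.
\<close>

lemma (in prob_space) indep_small_ball:
  fixes a b c :: "'b \<Rightarrow> real"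
  assumes ind: "indep_var N' W' N W"
    and [measurable]: "a \<in> borel_measurable N'" "c \<in> borel_measurable N" "b \<in> borel_measurable N"
    and b: "\<And>v. 0 \<le> b v" and K: "0 \<le> K"
    and ball: "\<And>u y. 0 \<le> y \<Longrightarrow> prob {\<omega> \<in> space M. \<bar>a (W' \<omega>) - u\<bar> \<le> y} \<le> K * y"
  shows "emeasure M {\<omega> \<in> space M. \<bar>a (W' \<omega>) - c (W \<omega>)\<bar> \<le> b (W \<omega>)}
    \<le> ennreal K * (\<integral>\<^sup>+\<omega>. ennreal (b (W \<omega>)) \<partial>M)"
proof -
  have W[measurable]: "W' \<in> measurable M N'" "W \<in> measurable M N"
    using indep_var_rv1[OF ind] indep_var_rv2[OF ind] by auto
  let ?S = "{p \<in> space (N' \<Otimes>\<^sub>M N). \<bar>a (fst p) - c (snd p)\<bar> \<le> b (snd p)}"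
  interpret A: prob_space "distr M N' W'" by (rule prob_space_distr) simp
  interpret W: prob_space "distr M N W" by (rule prob_space_distr) simp
  interpret P: pair_prob_space "distr M N' W'" "distr M N W" ..
  have S[measurable]: "?S \<in> sets (N' \<Otimes>\<^sub>M N)" by measurable
  have "emeasure M {\<omega> \<in> space M. \<bar>a (W' \<omega>) - c (W \<omega>)\<bar> \<le> b (W \<omega>)}
    = emeasure (distr M (N' \<Otimes>\<^sub>M N) (\<lambda>\<omega>. (W' \<omega>, W \<omega>))) ?S"
    by (subst emeasure_distr) (auto intro!: arg_cong2[where f=emeasure] simp: space_pair_measure
        dest: measurable_space[OF W(1)] measurable_space[OF W(2)])
  also have "\<dots> = emeasure (distr M N' W' \<Otimes>\<^sub>M distr M N W) ?S"
    using ind by (simp add: indep_var_distribution_eq)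
  also have "\<dots> = (\<integral>\<^sup>+v. emeasure (distr M N' W') ((\<lambda>u. (u, v)) -` ?S) \<partial>distr M N W)"
    by (rule P.emeasure_pair_measure_alt2) (simp cong: sets_pair_measure_cong)
  also have "\<dots> = (\<integral>\<^sup>+\<omega>. emeasure (distr M N' W') ((\<lambda>u. (u, W \<omega>)) -` ?S) \<partial>M)"
  proof (rule nn_integral_distr)
    have "(\<lambda>v. emeasure (distr M N' W') ((\<lambda>u. (u, v)) -` ?S)) \<in> borel_measurable (distr M N W)"
      by (rule P.measurable_emeasure_Pair2) (simp cong: sets_pair_measure_cong)
    then show "(\<lambda>v. emeasure (distr M N' W') ((\<lambda>u. (u, v)) -` ?S)) \<in> borel_measurable (distr M N W)" .
  qed simp
  also have "\<dots> \<le> (\<integral>\<^sup>+\<omega>. ennreal K * ennreal (b (W \<omega>)) \<partial>M)"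
  proof (rule nn_integral_mono)
    fix \<omega> assume \<omega>: "\<omega> \<in> space M"
    have "(\<lambda>u. (u, W \<omega>)) -` ?S = {u \<in> space N'. \<bar>a u - c (W \<omega>)\<bar> \<le> b (W \<omega>)}"
      using measurable_space[OF W(2) \<omega>] by (auto simp: space_pair_measure)
    moreover have "W' -` {u \<in> space N'. \<bar>a u - c (W \<omega>)\<bar> \<le> b (W \<omega>)} \<inter> space M
       = {\<omega>' \<in> space M. \<bar>a (W' \<omega>') - c (W \<omega>)\<bar> \<le> b (W \<omega>)}"
      using measurable_space[OF W(1)] by auto
    ultimately have "emeasure (distr M N' W') ((\<lambda>u. (u, W \<omega>)) -` ?S)
      = emeasure M {\<omega>' \<in> space M. \<bar>a (W' \<omega>') - c (W \<omega>)\<bar> \<le> b (W \<omega>)}"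
      by (simp add: emeasure_distr)
    also have "\<dots> \<le> ennreal (K * b (W \<omega>))"
      unfolding emeasure_eq_measure using ball b by (intro ennreal_leI) auto
    also have "\<dots> = ennreal K * ennreal (b (W \<omega>))" using b K by (simp add: ennreal_mult)
    finally show "emeasure (distr M N' W') ((\<lambda>u. (u, W \<omega>)) -` ?S) \<le> ennreal K * ennreal (b (W \<omega>))" .
  qed
  also have "\<dots> = ennreal K * (\<integral>\<^sup>+\<omega>. ennreal (b (W \<omega>)) \<partial>M)"
    by (rule nn_integral_cmult) measurable
  finally show ?thesis .
qed

lemma emeasure_eventually_le:
  assumes [measurable]: "\<And>n. Measurable.pred M (P n)"
    and le: "\<And>n. emeasure M {x \<in> space M. P n x} \<le> c"
  shows "emeasure M {x \<in> space M. \<exists>n0::nat. \<forall>n\<ge>n0. P n x} \<le> c"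
proof -
  let ?A = "\<lambda>n0. {x \<in> space M. \<forall>n\<ge>n0. P n x}"
  have "{x \<in> space M. \<exists>n0. \<forall>n\<ge>n0. P n x} = (\<Union>n0. ?A n0)" by auto
  also have "emeasure M (\<Union>n0. ?A n0) = (SUP n0. emeasure M (?A n0))"
    by (rule SUP_emeasure_incseq[symmetric]) (auto simp: incseq_def intro: order_trans)
  also have "\<dots> \<le> c"
  proof (rule SUP_least)
    fix n0
    show "emeasure M (?A n0) \<le> c" by (rule order_trans[OF emeasure_mono le[of n0]]) auto
  qed
  finally show ?thesis .
qed

lemma ex_iff_eventually:
  fixes P :: "nat \<Rightarrow> bool"
  assumes "\<And>m n. P m \<Longrightarrow> m \<le> n \<Longrightarrow> P n"
  shows "(\<exists>m. P m) \<longleftrightarrow> (\<exists>m0. \<forall>m\<ge>m0. P m)"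
proof
  assume "\<exists>m. P m"
  then obtain m where "P m" ..
  then have "\<forall>n\<ge>m. P n" using assms by blast
  then show "\<exists>m0. \<forall>m\<ge>m0. P m" ..
qed blast

lemma (in prob_space) prob_eventually_le:
  assumes "\<And>n. Measurable.pred M (P n)"
    and le: "\<And>n. prob {\<omega> \<in> space M. P n \<omega>} \<le> c"
  shows "prob {\<omega> \<in> space M. \<exists>n0::nat. \<forall>n\<ge>n0. P n \<omega>} \<le> c"
proof -
  have c: "0 \<le> c" using le[of 0] measure_nonneg order_trans by blast
  have "emeasure M {\<omega> \<in> space M. \<exists>n0. \<forall>n\<ge>n0. P n \<omega>} \<le> ennreal c"
    using assms(1) by (rule emeasure_eventually_le) (simp add: emeasure_eq_measure ennreal_leI le)
  then show ?thesis using c by (simp add: emeasure_eq_measure)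
qed

text \<open>
  The cells of the grid with mesh \<open>1 / 2 ^ n\<close> below time \<open>N\<close> number about \<open>N * 2 ^ n\<close>, so the union bound
  is of order \<open>N * c i\<close>, uniformly in \<open>n\<close>. The event that the \<open>i\<close>-th condition is met on all fine
  grids inherits this bound, and \<open>c i\<close> tends to \<open>0\<close>.
\<close>

lemma (in prob_space) grid_hits_null:
  fixes Q :: "nat \<Rightarrow> nat \<Rightarrow> nat \<Rightarrow> 'a \<Rightarrow> bool" and lo :: real and N :: nat
  assumes [measurable]: "\<And>i n k. Measurable.pred M (Q i n k)"
    and le: "\<And>i n k. \<lbrakk>lo \<le> k / 2^n; k / 2^n \<le> N\<rbrakk> \<Longrightarrow> prob {\<omega> \<in> space M. Q i n k \<omega>} \<le> c i / 2^n"
    and c: "\<And>i. 0 \<le> c i" "c \<longlonglongrightarrow> 0"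
  shows "AE \<omega> in M. \<not> (\<forall>i. \<exists>n0. \<forall>n\<ge>n0. \<exists>k::nat. lo \<le> k / 2^n \<and> k / 2^n \<le> N \<and> Q i n k \<omega>)"
proof -
  let ?P = "\<lambda>i n \<omega>. \<exists>k::nat. lo \<le> k / 2^n \<and> k / 2^n \<le> N \<and> Q i n k \<omega>"
  let ?E = "\<lambda>i. {\<omega> \<in> space M. \<exists>n0. \<forall>n\<ge>n0. ?P i n \<omega>}"
  have P: "prob {\<omega> \<in> space M. ?P i n \<omega>} \<le> (real N + 1) * c i" for i n
  proof -
    let ?K = "{k::nat. lo \<le> k / 2^n \<and> k / 2^n \<le> N}"
    have sub: "?K \<subseteq> {..N * 2^n}"
    proof
      fix k assume "k \<in> ?K"
      then have "real k \<le> real (N * 2^n)" by (simp add: field_simps)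
      then show "k \<in> {..N * 2^n}" by (simp only: of_nat_le_iff atMost_iff)
    qed
    then have fin: "finite ?K" by (rule finite_subset) simp
    have "card ?K \<le> N * 2^n + 1" using card_mono[OF _ sub] by simp
    also have "\<dots> \<le> N * 2^n + 2^n" by simp
    finally have "real (card ?K) \<le> real (N * 2^n + 2^n)" by (simp only: of_nat_le_iff)
    then have card: "real (card ?K) \<le> (real N + 1) * 2^n" by (simp add: algebra_simps)
    have "prob {\<omega> \<in> space M. ?P i n \<omega>} \<le> prob (\<Union>k\<in>?K. {\<omega> \<in> space M. Q i n k \<omega>})"
      using fin by (intro finite_measure_mono sets.finite_UN) auto
    also have "\<dots> \<le> (\<Sum>k\<in>?K. prob {\<omega> \<in> space M. Q i n k \<omega>})"
      by (rule finite_measure_subadditive_finite[OF fin]) auto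
    also have "\<dots> \<le> (\<Sum>k\<in>?K. c i / 2^n)" by (intro sum_mono le) auto
    also have "\<dots> = real (card ?K) * (c i / 2^n)" by simp
    also have "\<dots> \<le> ((real N + 1) * 2^n) * (c i / 2^n)" using card c by (intro mult_right_mono) auto
    also have "\<dots> = (real N + 1) * c i" by simp
    finally show ?thesis .
  qed
  have E: "prob (?E i) \<le> (real N + 1) * c i" for i
  proof (rule prob_eventually_le)
    show "Measurable.pred M (?P i n)" for n by measurable
    show "prob {\<omega> \<in> space M. ?P i n \<omega>} \<le> (real N + 1) * c i" for n by (rule P)
  qed
  have "prob {\<omega> \<in> space M. \<forall>i. \<exists>n0. \<forall>n\<ge>n0. ?P i n \<omega>} \<le> 0"
  proof (rule LIMSEQ_le_const)
    show "(\<lambda>i. (real N + 1) * c i) \<longlonglongrightarrow> 0" using tendsto_mult_left[OF c(2), of "real N + 1"] by simp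
    show "\<exists>i0. \<forall>i\<ge>i0. prob {\<omega> \<in> space M. \<forall>i. \<exists>n0. \<forall>n\<ge>n0. ?P i n \<omega>} \<le> (real N + 1) * c i"
      by (intro exI allI impI order_trans[OF finite_measure_mono E]) auto
  qed
  then have "prob {\<omega> \<in> space M. \<forall>i. \<exists>n0. \<forall>n\<ge>n0. ?P i n \<omega>} = 0"
    by (simp add: measure_le_0_iff)
  then show ?thesis by (subst (asm) prob_eq_0) (auto intro: AE_I2)
qed

context small_index_stable_process
begin

definition small_ball_const :: "real \<Rightarrow> real" where
  "small_ball_const \<epsilon> = (SOME K. 0 \<le> K \<and> (\<forall>\<mu> t. real_distribution \<mu> \<longrightarrow> \<epsilon> \<le> t \<longrightarrow>
    (\<forall>\<xi>. char \<mu> \<xi> = of_real (exp (- t * \<bar>\<xi>\<bar> powr \<alpha>))) \<longrightarrow>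
    (\<forall>u y. 0 \<le> y \<longrightarrow> measure \<mu> {z. \<bar>z - u\<bar> \<le> y} \<le> K * y)))"

lemma
  assumes "0 < \<epsilon>"
  shows small_ball_const_nonneg: "0 \<le> small_ball_const \<epsilon>"
    and Z_small_ball: "\<epsilon> \<le> t \<Longrightarrow> 0 \<le> y \<Longrightarrow> prob {\<omega> \<in> space M. \<bar>Z t \<omega> - u\<bar> \<le> y} \<le> small_ball_const \<epsilon> * y"
proof -
  note K = someI_ex[OF stable_small_ball[OF alpha_pos assms], folded small_ball_const_def]
  then show "0 \<le> small_ball_const \<epsilon>" by blast
  assume t: "\<epsilon> \<le> t" "0 \<le> y"
  with assms have t0: "0 \<le> t" by simp
  have "prob {\<omega> \<in> space M. \<bar>Z t \<omega> - u\<bar> \<le> y} = measure (distr M borel (Z t)) {z. \<bar>z - u\<bar> \<le> y}"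
    using t0 by (subst measure_distr) (auto simp: vimage_def Int_def conj_commute)
  also have "\<dots> \<le> small_ball_const \<epsilon> * y"
    using K t char_Z[OF t0] real_distribution_distr[OF random_variable_Z[OF t0]] by blast
  finally show "prob {\<omega> \<in> space M. \<bar>Z t \<omega> - u\<bar> \<le> y} \<le> small_ball_const \<epsilon> * y" .
qed

text \<open>
  The position at time \<open>t\<close> is independent of all later increments, so the centre and the radius of the
  ball may depend on them.
\<close>

lemma future_increments_small_ball:
  fixes c b :: "(nat \<Rightarrow> real) \<Rightarrow> real"
  assumes e: "0 < \<epsilon>" and t: "\<epsilon> \<le> t" and h: "0 \<le> h"
    and cb: "c \<in> borel_measurable (PiM {1..n} (\<lambda>_. borel))" "b \<in> borel_measurable (PiM {1..n} (\<lambda>_. borel))"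
    and b: "\<And>v. 0 \<le> b v"
  defines "D \<equiv> \<lambda>\<omega>. \<lambda>i\<in>{1..n}. Z (t + real i * h) \<omega> - Z (t + real (i - 1) * h) \<omega>"
  shows "emeasure M {\<omega> \<in> space M. \<bar>Z t \<omega> - c (D \<omega>)\<bar> \<le> b (D \<omega>)}
    \<le> ennreal (small_ball_const \<epsilon>) * (\<integral>\<^sup>+\<omega>. ennreal (b (D \<omega>)) \<partial>M)"
proof -
  \<comment> \<open>Partition points \<open>0, t, t + h, t + 2 * h, ...\<close>: the increment number \<open>0\<close> is \<open>Z t - Z 0\<close>.\<close>
  define r where "r i = (if i = 0 then 0 else t + real (i - 1) * h)" for i
  define X where "X i \<omega> = Z (r (Suc i)) \<omega> - Z (r i) \<omega>" for i \<omega>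
  have t0: "0 \<le> t" using e t by simp
  have ri: "r i \<le> r (Suc i)" for i
    using h t0 by (cases i) (auto simp: r_def algebra_simps)
  have ind: "indep_vars (\<lambda>_. borel) X {..<Suc n}"
    unfolding X_def by (intro indep_increments ri) (simp add: r_def)
  have "indep_var (PiM {0} (\<lambda>_. borel)) (\<lambda>\<omega>. restrict (\<lambda>i. X i \<omega>) {0})
     (PiM {1..n} (\<lambda>_. borel)) (\<lambda>\<omega>. restrict (\<lambda>i. X i \<omega>) {1..n})"
    by (rule indep_var_restrict[OF ind]) auto
  moreover have "(\<lambda>\<omega>. restrict (\<lambda>i. X i \<omega>) {1..n}) = D"
    unfolding D_def X_def r_def by (intro ext restrict_ext) auto
  ultimately have ind2: "indep_var (PiM {0} (\<lambda>_. borel)) (\<lambda>\<omega>. restrict (\<lambda>i. X i \<omega>) {0})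
     (PiM {1..n} (\<lambda>_. borel)) D" by simp
  have X0: "restrict (\<lambda>i. X i \<omega>) {0} 0 = Z t \<omega> - Z 0 \<omega>" for \<omega>
    by (simp add: X_def r_def)
  note [measurable] = indep_var_rv2[OF ind2] cb
  have [measurable]: "Z t \<in> borel_measurable M" "Z 0 \<in> borel_measurable M" using t0 by auto
  have "emeasure M {\<omega> \<in> space M. \<bar>Z t \<omega> - c (D \<omega>)\<bar> \<le> b (D \<omega>)}
    = emeasure M {\<omega> \<in> space M. \<bar>restrict (\<lambda>i. X i \<omega>) {0} 0 - c (D \<omega>)\<bar> \<le> b (D \<omega>)}"
    unfolding X0 using start_zero by (intro emeasure_eq_AE) auto
  also have "\<dots> \<le> ennreal (small_ball_const \<epsilon>) * (\<integral>\<^sup>+\<omega>. ennreal (b (D \<omega>)) \<partial>M)"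
  proof (rule indep_small_ball[OF ind2 _ cb b small_ball_const_nonneg[OF e]])
    show "(\<lambda>f. f 0) \<in> borel_measurable (PiM {0::nat} (\<lambda>_. borel :: real measure))" by simp
    fix u y :: real assume "0 \<le> y"
    have "prob {\<omega> \<in> space M. \<bar>restrict (\<lambda>i. X i \<omega>) {0} 0 - u\<bar> \<le> y} = prob {\<omega> \<in> space M. \<bar>Z t \<omega> - u\<bar> \<le> y}"
      unfolding X0 using start_zero by (intro finite_measure_eq_AE) auto
    also have "\<dots> \<le> small_ball_const \<epsilon> * y" by (rule Z_small_ball) fact+
    finally show "prob {\<omega> \<in> space M. \<bar>restrict (\<lambda>i. X i \<omega>) {0} 0 - u\<bar> \<le> y} \<le> small_ball_const \<epsilon> * y" .
  qed
  finally show ?thesis .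
qed

end

section \<open>Jumps at a level and downward creeping have probability zero\<close>

text \<open>
  What a jump from or onto the level \<open>a\<close> leaves on the dyadic grids: for any tolerance \<open>1 / Suc i\<close>, every
  fine enough grid has a cell with an increment that stays large (after removing the drift
  \<open>1 / 2 ^ n\<close>) and with one end point whose value is near \<open>a\<close>. The numbers \<open>j\<close> and \<open>N\<close> bound the jump
  size from below and confine the time to \<open>[1 / Suc j, N]\<close>, away from \<open>0\<close>, where small ball bounds
  are available.
\<close>

definition jump_near :: "real \<Rightarrow> (real \<Rightarrow> real) \<Rightarrow> bool" where
  "jump_near a w \<longleftrightarrow> (\<exists>j N. \<forall>i. \<exists>n0. \<forall>n\<ge>n0. \<exists>k::nat.
     1 / real (Suc j) \<le> real k / 2^n \<and> real k / 2^n \<le> real (N::nat) \<and>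
     1 / real (Suc j) < \<bar>w (real k / 2^n + 1 / 2^n) - w (real k / 2^n) - 1 / 2^n\<bar> \<and>
     (\<bar>w (real k / 2^n) - a\<bar> \<le> 1 / real (Suc i) \<or> \<bar>w (real k / 2^n + 1 / 2^n) - a\<bar> \<le> 1 / real (Suc i)))"

text \<open>
  What a continuous first hit of \<open>0\<close> from above leaves on the dyadic grids: the value at the left end of
  some cell is small and is also at most twice the variation over that cell of the path without
  its drift. The factor \<open>2\<close> replaces the supremum over \<open>m\<close>, which need not be attained, by a
  single \<open>m\<close>.
\<close>

definition creep_down_near :: "(real \<Rightarrow> real) \<Rightarrow> bool" where
  "creep_down_near w \<longleftrightarrow> (\<exists>j N. \<forall>i. \<exists>n0. \<forall>n\<ge>n0. \<exists>k::nat.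
     1 / real (Suc j) \<le> real k / 2^n \<and> real k / 2^n \<le> real (N::nat) \<and>
     (\<exists>m. \<bar>w (real k / 2^n)\<bar> \<le> 1 / real (Suc i) \<and>
       \<bar>w (real k / 2^n)\<bar> \<le> 2 * dyadic_variation m (real k / 2^n) (1 / 2^n) (\<lambda>t. w t - t)))"

context small_index_stable_process
begin

text \<open>
  The two alternatives differ only in the centre of the ball for \<open>Z t\<close>: it is the constant \<open>u\<close>, or \<open>v\<close>
  minus the increment over the cell. The radius is \<open>\<delta>\<close> if the increment is large and \<open>0\<close> otherwise, so
  its mean is \<open>\<delta>\<close> times a tail probability.
\<close>

lemma jump_small_ball:
  assumes e: "0 < \<epsilon>" and t: "\<epsilon> \<le> t" and h: "0 \<le> h" and \<eta>: "0 < \<eta>" and \<delta>: "0 \<le> \<delta>"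
  shows "prob {\<omega> \<in> space M. \<eta> < \<bar>Z (t + h) \<omega> - Z t \<omega>\<bar> \<and> (\<bar>Z t \<omega> - u\<bar> \<le> \<delta> \<or> \<bar>Z (t + h) \<omega> - v\<bar> \<le> \<delta>)}
    \<le> 2 * small_ball_const \<epsilon> * \<delta> * (2 / (1 - exp (- (1/2))) * h * \<eta> powr - \<alpha>)"
proof -
  let ?K = "small_ball_const \<epsilon>" and ?T = "2 / (1 - exp (- (1/2))) * h * \<eta> powr - \<alpha>"
  have t0: "0 \<le> t" and th: "0 \<le> t + h" using e t h by auto
  note [measurable] = random_variable_Z[OF t0] random_variable_Z[OF th]
  \<comment> \<open>One cell only, so the vector of later increments has the single entry number \<open>1\<close>.\<close>
  define b where "b v = (if \<eta> < \<bar>v 1\<bar> then \<delta> else 0)" for v :: "nat \<Rightarrow> real"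
  have comp: "(\<lambda>v. v 1) \<in> borel_measurable (PiM {1..1::nat} (\<lambda>_. borel :: real measure))" by simp
  note comp[measurable]
  have b[measurable]: "b \<in> borel_measurable (PiM {1..1} (\<lambda>_. borel))" unfolding b_def by measurable
  define D where "D \<omega> = (\<lambda>i\<in>{1..1::nat}. Z (t + real i * h) \<omega> - Z (t + real (i - 1) * h) \<omega>)" for \<omega>
  have D1: "D \<omega> 1 = Z (t + h) \<omega> - Z t \<omega>" for \<omega> by (simp add: D_def)
  have bound: "prob {\<omega> \<in> space M. \<eta> < \<bar>Z (t + h) \<omega> - Z t \<omega>\<bar> \<and> \<bar>Z t \<omega> - c (D \<omega>)\<bar> \<le> \<delta>} \<le> ?K * \<delta> * ?T"
    if c: "c \<in> borel_measurable (PiM {1..1} (\<lambda>_. borel))" and cD: "(\<lambda>\<omega>. c (D \<omega>)) \<in> borel_measurable M" for c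
  proof -
    note [measurable] = c cD
    have "emeasure M {\<omega> \<in> space M. \<eta> < \<bar>Z (t + h) \<omega> - Z t \<omega>\<bar> \<and> \<bar>Z t \<omega> - c (D \<omega>)\<bar> \<le> \<delta>}
      \<le> emeasure M {\<omega> \<in> space M. \<bar>Z t \<omega> - c (D \<omega>)\<bar> \<le> b (D \<omega>)}"
      using D1 by (intro emeasure_mono) (auto simp: b_def)
    also have "\<dots> \<le> ennreal ?K * (\<integral>\<^sup>+\<omega>. ennreal (b (D \<omega>)) \<partial>M)"
      unfolding D_def by (rule future_increments_small_ball[OF e t h c b]) (simp add: b_def \<delta>)
    also have "(\<integral>\<^sup>+\<omega>. ennreal (b (D \<omega>)) \<partial>M) \<le>
        (\<integral>\<^sup>+\<omega>. ennreal \<delta> * indicator {\<omega> \<in> space M. \<eta> \<le> \<bar>Z (t + h) \<omega> - Z t \<omega>\<bar>} \<omega> \<partial>M)"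
      using D1 by (intro nn_integral_mono) (auto simp: b_def)
    also have "\<dots> = ennreal \<delta> * emeasure M {\<omega> \<in> space M. \<eta> \<le> \<bar>Z (t + h) \<omega> - Z t \<omega>\<bar>}"
      by (rule nn_integral_cmult_indicator) measurable
    also have "\<dots> \<le> ennreal \<delta> * ennreal ?T"
      unfolding emeasure_eq_measure by (intro mult_left_mono ennreal_leI increment_tail[OF t0 h \<eta>]) simp
    finally have "emeasure M {\<omega> \<in> space M. \<eta> < \<bar>Z (t + h) \<omega> - Z t \<omega>\<bar> \<and> \<bar>Z t \<omega> - c (D \<omega>)\<bar> \<le> \<delta>}
      \<le> ennreal ?K * (ennreal \<delta> * ennreal ?T)" by (simp add: mult_left_mono)
    also have "\<dots> = ennreal (?K * \<delta> * ?T)"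
      using small_ball_const_nonneg[OF e] \<delta> h by (simp add: ennreal_mult[symmetric] mult.assoc)
    finally show ?thesis
      using small_ball_const_nonneg[OF e] \<delta> h by (simp add: emeasure_eq_measure)
  qed
  have 1: "prob {\<omega> \<in> space M. \<eta> < \<bar>Z (t + h) \<omega> - Z t \<omega>\<bar> \<and> \<bar>Z t \<omega> - u\<bar> \<le> \<delta>} \<le> ?K * \<delta> * ?T"
    by (rule bound) auto
  have "prob {\<omega> \<in> space M. \<eta> < \<bar>Z (t + h) \<omega> - Z t \<omega>\<bar> \<and> \<bar>Z t \<omega> - (v - D \<omega> 1)\<bar> \<le> \<delta>} \<le> ?K * \<delta> * ?T"
    by (rule bound) (use D1 in auto)
  then have 2: "prob {\<omega> \<in> space M. \<eta> < \<bar>Z (t + h) \<omega> - Z t \<omega>\<bar> \<and> \<bar>Z (t + h) \<omega> - v\<bar> \<le> \<delta>} \<le> ?K * \<delta> * ?T"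
    unfolding D1 by (simp add: algebra_simps)
  have "prob {\<omega> \<in> space M. \<eta> < \<bar>Z (t + h) \<omega> - Z t \<omega>\<bar> \<and> (\<bar>Z t \<omega> - u\<bar> \<le> \<delta> \<or> \<bar>Z (t + h) \<omega> - v\<bar> \<le> \<delta>)}
    \<le> prob ({\<omega> \<in> space M. \<eta> < \<bar>Z (t + h) \<omega> - Z t \<omega>\<bar> \<and> \<bar>Z t \<omega> - u\<bar> \<le> \<delta>} \<union>
        {\<omega> \<in> space M. \<eta> < \<bar>Z (t + h) \<omega> - Z t \<omega>\<bar> \<and> \<bar>Z (t + h) \<omega> - v\<bar> \<le> \<delta>})"
    by (intro finite_measure_mono) auto
  also have "\<dots> \<le> ?K * \<delta> * ?T + ?K * \<delta> * ?T"
    by (rule order_trans[OF measure_Un_le add_mono[OF 1 2]]) measurable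
  finally show ?thesis by (simp only: mult_2 distrib_right)
qed

lemma tendsto_inverse_Suc_powr:
  fixes p :: real assumes "0 < p" shows "(\<lambda>i. (1 / real (Suc i)) powr p) \<longlonglongrightarrow> 0"
proof -
  have "(\<lambda>i. (1 / real (Suc i)) powr p) \<longlonglongrightarrow> 0 powr p"
    using assms by (intro tendsto_powr2 lim_1_over_n[THEN LIMSEQ_Suc, unfolded One_nat_def] tendsto_const) 
      (auto simp: LIMSEQ_inverse_real_of_nat lim_1_over_n)
  then show ?thesis by simp
qed

lemma AE_not_jump_near: "AE \<omega> in M. \<not> jump_near a (\<lambda>t. x + Z t \<omega> + t)"
proof -
  let ?w = "\<lambda>\<omega> t. x + Z t \<omega> + t"
  have "AE \<omega> in M. \<not> (\<forall>i. \<exists>n0. \<forall>n\<ge>n0. \<exists>k::nat. 1 / real (Suc j) \<le> real k / 2^n \<and> real k / 2^n \<le> real N \<and>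
     (1 / real (Suc j) < \<bar>?w \<omega> (real k / 2^n + 1 / 2^n) - ?w \<omega> (real k / 2^n) - 1 / 2^n\<bar> \<and>
     (\<bar>?w \<omega> (real k / 2^n) - a\<bar> \<le> 1 / real (Suc i) \<or> \<bar>?w \<omega> (real k / 2^n + 1 / 2^n) - a\<bar> \<le> 1 / real (Suc i))))"
    for j N :: nat
  proof (rule grid_hits_null)
    let ?K = "small_ball_const (1 / real (Suc j))" and ?c = "2 / (1 - exp (- (1/2))) * (1 / real (Suc j)) powr - \<alpha>"
    show "Measurable.pred M (\<lambda>\<omega>. 1 / real (Suc j) < \<bar>?w \<omega> (real k / 2^n + 1 / 2^n) - ?w \<omega> (real k / 2^n) - 1 / 2^n\<bar> \<and>
     (\<bar>?w \<omega> (real k / 2^n) - a\<bar> \<le> 1 / real (Suc i) \<or> \<bar>?w \<omega> (real k / 2^n + 1 / 2^n) - a\<bar> \<le> 1 / real (Suc i)))" for i n k :: nat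
      by measurable
    show "0 \<le> 2 * ?K * (1 / real (Suc i)) * ?c" for i
      by (intro mult_nonneg_nonneg small_ball_const_nonneg) auto
    show "(\<lambda>i. 2 * ?K * (1 / real (Suc i)) * ?c) \<longlonglongrightarrow> 0"
      by (intro tendsto_mult_left_zero tendsto_mult_right_zero) (rule LIMSEQ_Suc[OF lim_1_over_n])
    fix i n k :: nat
    assume lo: "1 / real (Suc j) \<le> real k / 2^n"
    let ?t = "real k / 2^n" and ?h = "1 / 2^n :: real"
    have "{\<omega> \<in> space M. 1 / real (Suc j) < \<bar>?w \<omega> (?t + ?h) - ?w \<omega> ?t - ?h\<bar> \<and>
       (\<bar>?w \<omega> ?t - a\<bar> \<le> 1 / real (Suc i) \<or> \<bar>?w \<omega> (?t + ?h) - a\<bar> \<le> 1 / real (Suc i))}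
      = {\<omega> \<in> space M. 1 / real (Suc j) < \<bar>Z (?t + ?h) \<omega> - Z ?t \<omega>\<bar> \<and>
       (\<bar>Z ?t \<omega> - (a - x - ?t)\<bar> \<le> 1 / real (Suc i) \<or> \<bar>Z (?t + ?h) \<omega> - (a - x - ?t - ?h)\<bar> \<le> 1 / real (Suc i))}"
      by (intro Collect_cong conj_cong refl arg_cong2[where f="(\<or>)"] arg_cong2[where f="(\<le>)"] arg_cong2[where f="(<)"] arg_cong[where f=abs]) auto
    also have "prob \<dots> \<le> 2 * ?K * (1 / real (Suc i)) * (2 / (1 - exp (- (1/2))) * ?h * (1 / real (Suc j)) powr - \<alpha>)"
      using lo by (intro jump_small_ball) auto
    also have "\<dots> = 2 * ?K * (1 / real (Suc i)) * ?c / 2^n" by simp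
    finally show "prob {\<omega> \<in> space M. 1 / real (Suc j) < \<bar>?w \<omega> (?t + ?h) - ?w \<omega> ?t - ?h\<bar> \<and>
       (\<bar>?w \<omega> ?t - a\<bar> \<le> 1 / real (Suc i) \<or> \<bar>?w \<omega> (?t + ?h) - a\<bar> \<le> 1 / real (Suc i))}
      \<le> 2 * ?K * (1 / real (Suc i)) * ?c / 2^n" .
  qed
  then show ?thesis unfolding jump_near_def not_ex AE_all_countable by blast
qed

text \<open>
  The radius is the minimum of \<open>\<delta>\<close> and twice the variation over the cell, whose mean
  \<open>truncated_variation\<close> bounds by \<open>h\<close> times a power of \<open>\<delta>\<close> with positive exponent. The bound holds
  for each \<open>m\<close>, and the events increase with \<open>m\<close>.
\<close>

lemma variation_small_ball:
  assumes e: "0 < \<epsilon>" and t: "\<epsilon> \<le> t" and h: "0 \<le> h" and \<delta>: "0 < \<delta>"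
  shows "prob {\<omega> \<in> space M. \<exists>m. \<bar>Z t \<omega> - u\<bar> \<le> \<delta> \<and> \<bar>Z t \<omega> - u\<bar> \<le> 2 * dyadic_variation m t h (\<lambda>t. Z t \<omega>)}
    \<le> 2 * small_ball_const \<epsilon> * increment_const * h * \<delta> powr (1 - \<alpha>)"
proof -
  let ?K = "small_ball_const \<epsilon>" and ?T = "increment_const * h * \<delta> powr (1 - \<alpha>)"
  let ?V = "\<lambda>m \<omega>. dyadic_variation m t h (\<lambda>t. Z t \<omega>)"
  let ?P = "\<lambda>m \<omega>. \<bar>Z t \<omega> - u\<bar> \<le> \<delta> \<and> \<bar>Z t \<omega> - u\<bar> \<le> 2 * ?V m \<omega>"
  have t0: "0 \<le> t" using e t by auto
  note [measurable] = random_variable_Z[OF t0] dyadic_variation_measurable[OF t0 h]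
  have KT: "0 \<le> ?K" "0 \<le> ?T"
    using small_ball_const_nonneg[OF e] increment_const_nonneg h by auto
  have P: "prob {\<omega> \<in> space M. ?P m \<omega>} \<le> 2 * ?K * ?T" for m
  proof -
    define b where "b v = min \<delta> (2 * (\<Sum>i\<in>{1..2^m}. \<bar>v i\<bar>))" for v :: "nat \<Rightarrow> real"
    have b[measurable]: "b \<in> borel_measurable (PiM {1..2^m} (\<lambda>_. borel))" unfolding b_def by measurable
    define D where "D \<omega> = (\<lambda>i\<in>{1..2^m::nat}. Z (t + real i * (h / 2^m)) \<omega> - Z (t + real (i - 1) * (h / 2^m)) \<omega>)" for \<omega>
    have "(\<Sum>i\<in>{1..2^m}. \<bar>D \<omega> i\<bar>) = ?V m \<omega>" for \<omega>
      unfolding dyadic_variation_def One_nat_def sum.atLeast1_atMost_eq by (simp add: D_def)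
    then have bD: "b (D \<omega>) = min \<delta> (2 * ?V m \<omega>)" for \<omega> by (simp add: b_def)
    have "emeasure M {\<omega> \<in> space M. ?P m \<omega>} = emeasure M {\<omega> \<in> space M. \<bar>Z t \<omega> - u\<bar> \<le> b (D \<omega>)}"
      unfolding bD by (simp only: min.bounded_iff)
    also have "\<dots> \<le> ennreal ?K * (\<integral>\<^sup>+\<omega>. ennreal (b (D \<omega>)) \<partial>M)"
      unfolding D_def using h \<delta>
      by (intro future_increments_small_ball[OF e t _ _ b, where c="\<lambda>_. u"]) (auto simp: b_def sum_nonneg)
    also have "(\<integral>\<^sup>+\<omega>. ennreal (b (D \<omega>)) \<partial>M) \<le> (\<integral>\<^sup>+\<omega>. 2 * ennreal (min (?V m \<omega>) \<delta>) \<partial>M)"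
    proof (intro nn_integral_mono)
      fix \<omega>
      have "b (D \<omega>) \<le> 2 * min (?V m \<omega>) \<delta>" using \<delta> by (auto simp: bD min_def)
      then have "ennreal (b (D \<omega>)) \<le> ennreal (2 * min (?V m \<omega>) \<delta>)" by (rule ennreal_leI)
      then show "ennreal (b (D \<omega>)) \<le> 2 * ennreal (min (?V m \<omega>) \<delta>)"
        using \<delta> by (simp add: ennreal_mult' dyadic_variation_nonneg)
    qed
    also have "\<dots> = 2 * (\<integral>\<^sup>+\<omega>. ennreal (min (?V m \<omega>) \<delta>) \<partial>M)"
      by (rule nn_integral_cmult) measurable
    also have "\<dots> \<le> 2 * ennreal ?T"
      by (intro mult_left_mono truncated_variation[OF t0 h \<delta>]) simp
    finally have "emeasure M {\<omega> \<in> space M. ?P m \<omega>} \<le> ennreal ?K * (2 * ennreal ?T)"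
      by (simp add: mult_left_mono)
    also have "\<dots> = ennreal (2 * ?K * ?T)"
    proof -
      have "ennreal K * (2 * ennreal T) = ennreal (2 * K * T)" if "0 \<le> K" "0 \<le> T" for K T :: real
        using that by (simp add: ennreal_mult mult_ac)
      then show ?thesis using KT by blast
    qed
    finally have "ennreal (prob {\<omega> \<in> space M. ?P m \<omega>}) \<le> ennreal (2 * ?K * ?T)"
      by (simp only: emeasure_eq_measure)
    then show ?thesis by (rule iffD1[OF ennreal_le_iff, rotated]) (intro mult_nonneg_nonneg KT; simp)
  qed
  have "prob {\<omega> \<in> space M. \<exists>m0. \<forall>m\<ge>m0. ?P m \<omega>} \<le> 2 * ?K * ?T"
    by (rule prob_eventually_le[OF _ P]) measurable
  moreover have "(\<exists>m. ?P m \<omega>) \<longleftrightarrow> (\<exists>m0. \<forall>m\<ge>m0. ?P m \<omega>)" for \<omega>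
  proof (rule ex_iff_eventually)
    fix m n assume "?P m \<omega>" "m \<le> n"
    then show "?P n \<omega>" using dyadic_variation_mono[of m n t h "\<lambda>t. Z t \<omega>"] by linarith
  qed
  ultimately have "prob {\<omega> \<in> space M. \<exists>m. ?P m \<omega>} \<le> 2 * ?K * ?T" by (simp only:)
  then show ?thesis by (simp only: mult.assoc)
qed

lemma AE_not_creep_down_near: "AE \<omega> in M. \<not> creep_down_near (\<lambda>t. x + Z t \<omega> + t)"
proof -
  let ?w = "\<lambda>\<omega> t. x + Z t \<omega> + t"
  have V: "dyadic_variation m s h (\<lambda>t. ?w \<omega> t - t) = dyadic_variation m s h (\<lambda>t. Z t \<omega>)" for m s h \<omega>
    by (simp add: dyadic_variation_def)
  have "AE \<omega> in M. \<not> (\<forall>i. \<exists>n0. \<forall>n\<ge>n0. \<exists>k::nat. 1 / real (Suc j) \<le> real k / 2^n \<and> real k / 2^n \<le> real N \<and>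
     (\<exists>m. \<bar>?w \<omega> (real k / 2^n)\<bar> \<le> 1 / real (Suc i) \<and>
       \<bar>?w \<omega> (real k / 2^n)\<bar> \<le> 2 * dyadic_variation m (real k / 2^n) (1 / 2^n) (\<lambda>t. Z t \<omega>)))"
    for j N :: nat
  proof (rule grid_hits_null)
    let ?K = "small_ball_const (1 / real (Suc j))"
    show "Measurable.pred M (\<lambda>\<omega>. \<exists>m. \<bar>?w \<omega> (real k / 2^n)\<bar> \<le> 1 / real (Suc i) \<and>
       \<bar>?w \<omega> (real k / 2^n)\<bar> \<le> 2 * dyadic_variation m (real k / 2^n) (1 / 2^n) (\<lambda>t. Z t \<omega>))" for i n k :: nat
      by measurable
    show "0 \<le> 2 * ?K * increment_const * (1 / real (Suc i)) powr (1 - \<alpha>)" for i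
      by (intro mult_nonneg_nonneg small_ball_const_nonneg increment_const_nonneg) auto
    show "(\<lambda>i. 2 * ?K * increment_const * (1 / real (Suc i)) powr (1 - \<alpha>)) \<longlonglongrightarrow> 0"
      using alpha_less_1 by (intro tendsto_mult_right_zero tendsto_inverse_Suc_powr) simp
    fix i n k :: nat
    assume lo: "1 / real (Suc j) \<le> real k / 2^n"
    let ?t = "real k / 2^n" and ?h = "1 / 2^n :: real"
    have "{\<omega> \<in> space M. \<exists>m. \<bar>?w \<omega> ?t\<bar> \<le> 1 / real (Suc i) \<and> \<bar>?w \<omega> ?t\<bar> \<le> 2 * dyadic_variation m ?t ?h (\<lambda>t. Z t \<omega>)}
      = {\<omega> \<in> space M. \<exists>m. \<bar>Z ?t \<omega> - (- x - ?t)\<bar> \<le> 1 / real (Suc i) \<and>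
          \<bar>Z ?t \<omega> - (- x - ?t)\<bar> \<le> 2 * dyadic_variation m ?t ?h (\<lambda>t. Z t \<omega>)}"
      by (simp add: algebra_simps)
    also have "prob \<dots> \<le> 2 * ?K * increment_const * ?h * (1 / real (Suc i)) powr (1 - \<alpha>)"
      using lo by (intro variation_small_ball) auto
    also have "\<dots> = 2 * ?K * increment_const * (1 / real (Suc i)) powr (1 - \<alpha>) / 2^n" by simp
    finally show "prob {\<omega> \<in> space M. \<exists>m. \<bar>?w \<omega> ?t\<bar> \<le> 1 / real (Suc i) \<and>
        \<bar>?w \<omega> ?t\<bar> \<le> 2 * dyadic_variation m ?t ?h (\<lambda>t. Z t \<omega>)}
      \<le> 2 * ?K * increment_const * (1 / real (Suc i)) powr (1 - \<alpha>) / 2^n" .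
  qed
  then show ?thesis unfolding creep_down_near_def not_ex AE_all_countable V by blast
qed

end

section \<open>Deterministic facts about cadlag paths\<close>

lemma cadlag_right_nbhd:
  assumes "cadlag w" "0 \<le> s" "0 < e"
  obtains d where "0 < d" "\<And>y. s \<le> y \<Longrightarrow> y < s + d \<Longrightarrow> \<bar>w y - w s\<bar> < e"
proof -
  have "(w \<longlongrightarrow> w s) (at_right s)"
    using assms(1,2) by (auto simp: cadlag_def continuous_within)
  from tendstoD[OF this \<open>0 < e\<close>] obtain b where b: "s < b" "\<And>y. s < y \<Longrightarrow> y < b \<Longrightarrow> dist (w y) (w s) < e"
    unfolding eventually_at_right_field by blast
  have "\<bar>w y - w s\<bar> < e" if "s \<le> y" "y < s + (b - s)" for y
    using b(2)[of y] that \<open>0 < e\<close> by (cases "y = s") (auto simp: dist_real_def)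
  then show thesis using b(1) by (intro that[of "b - s"]) auto
qed

lemma left_limit_nbhd:
  fixes w :: "real \<Rightarrow> real"
  assumes "(w \<longlongrightarrow> l) (at_left s)" "0 < e"
  obtains d where "0 < d" "\<And>y. s - d < y \<Longrightarrow> y < s \<Longrightarrow> \<bar>w y - l\<bar> < e"
proof -
  from tendstoD[OF assms] obtain b where b: "b < s" "\<And>y. b < y \<Longrightarrow> y < s \<Longrightarrow> dist (w y) l < e"
    unfolding eventually_at_left_field by blast
  then show thesis by (intro that[of "s - b"]) (auto simp: dist_real_def)
qed

lemma cadlag_left_limit:
  assumes "cadlag w" "0 < s"
  obtains l where "(w \<longlongrightarrow> l) (at_left s)"
  using assms by (auto simp: cadlag_def)

lemma grid_bracket:
  fixes s h :: real
  assumes "0 < s" "0 < h"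
  obtains k :: nat where "real k * h < s" "s \<le> real (Suc k) * h"
proof -
  let ?c = "\<lceil>s / h\<rceil>"
  have c: "of_int ?c - 1 < s / h" "s / h \<le> of_int ?c" "0 < s / h"
    using assms by (linarith, linarith, simp)
  then have "0 < ?c" by linarith
  define k where "k = nat (?c - 1)"
  have k: "real k = of_int ?c - 1" using \<open>0 < ?c\<close> by (simp add: k_def)
  show thesis
  proof (rule that)
    show "real k * h < s" using c(1) assms unfolding k by (simp add: field_simps)
    show "s \<le> real (Suc k) * h" using mult_right_mono[OF c(2), of h] assms k by simp
  qed
qed

lemma ex_small_power:
  fixes d :: real assumes "0 < d"
  obtains n0 where "\<And>n. n0 \<le> n \<Longrightarrow> 1 / 2^n < d"
proof -
  obtain n0 where n0: "(1/2)^n0 < d" using real_arch_pow_inv[OF assms, of "1/2"] by auto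
  have "1 / 2^n < d" if "n0 \<le> n" for n
    using power_decreasing[OF that, of "1/2 :: real"] n0 by (simp add: power_one_over)
  then show thesis by (rule that)
qed

lemma ex_inverse_Suc_less:
  fixes d :: real assumes "0 < d" obtains j where "1 / real (Suc j) < d"
  using reals_Archimedean[OF assms] by (auto simp: inverse_eq_divide)

text \<open>
  Bracket the jump time between consecutive grid points. By right continuity and the left limit the
  values at the two ends of the bracket tend to the values after and before the jump.
\<close>

lemma jump_near_of_jump:
  assumes w: "cadlag w" and s: "0 < s" and l: "(w \<longlongrightarrow> l) (at_left s)" and jump: "l \<noteq> w s"
    and a: "l = a \<or> w s = a"
  shows "jump_near a w"
proof -
  let ?\<eta> = "\<bar>w s - l\<bar>"
  have eta: "0 < ?\<eta>" using jump by simp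
  then obtain j where j: "1 / real (Suc j) < min (?\<eta> / 2) (s / 2)"
    using ex_inverse_Suc_less[of "min (?\<eta> / 2) (s / 2)"] s by auto
  obtain N :: nat where N: "s \<le> real N" using real_arch_simple by blast
  show ?thesis
    unfolding jump_near_def
  proof (rule exI[of _ j], rule exI[of _ N], rule allI)
    fix i :: nat
    let ?e = "min (?\<eta> / 8) (1 / real (Suc i))"
    have e: "0 < ?e" using eta by simp
    obtain d1 where d1: "0 < d1" "\<And>y. s \<le> y \<Longrightarrow> y < s + d1 \<Longrightarrow> \<bar>w y - w s\<bar> < ?e"
      using cadlag_right_nbhd[OF w _ e, of s] s by auto
    obtain d2 where d2: "0 < d2" "\<And>y. s - d2 < y \<Longrightarrow> y < s \<Longrightarrow> \<bar>w y - l\<bar> < ?e"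
      using left_limit_nbhd[OF l e] by auto
    obtain n0 where n0: "\<And>n. n0 \<le> n \<Longrightarrow> 1 / 2^n < min (min d1 d2) (min (s / 2) (?\<eta> / 8))"
      using ex_small_power[of "min (min d1 d2) (min (s / 2) (?\<eta> / 8))"] d1(1) d2(1) s eta by auto
    show "\<exists>n0. \<forall>n\<ge>n0. \<exists>k::nat. 1 / real (Suc j) \<le> real k / 2^n \<and> real k / 2^n \<le> real N \<and>
     1 / real (Suc j) < \<bar>w (real k / 2^n + 1 / 2^n) - w (real k / 2^n) - 1 / 2^n\<bar> \<and>
     (\<bar>w (real k / 2^n) - a\<bar> \<le> 1 / real (Suc i) \<or> \<bar>w (real k / 2^n + 1 / 2^n) - a\<bar> \<le> 1 / real (Suc i))"
    proof (rule exI[of _ n0], intro allI impI)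
      fix n assume n: "n0 \<le> n"
      let ?h = "1 / 2^n :: real"
      have h: "0 < ?h" "?h < d1" "?h < d2" "?h < s / 2" "?h < ?\<eta> / 8" using n0[OF n] by auto
      obtain k where k: "real k * ?h < s" "s \<le> real (Suc k) * ?h" using grid_bracket[OF s h(1)] .
      let ?t = "real k / 2^n"
      have t: "?t < s" "s \<le> ?t + ?h" using k by (simp_all add: field_simps)
      have 1: "\<bar>w (?t + ?h) - w s\<bar> < ?e" using t h by (intro d1) auto
      have 2: "\<bar>w ?t - l\<bar> < ?e" using t h by (intro d2) auto
      have "1 / real (Suc j) \<le> ?t" "?t \<le> real N" using t h j N by auto
      moreover have "1 / real (Suc j) < \<bar>w (?t + ?h) - w ?t - ?h\<bar>"
      proof -
        have "\<bar>w (?t + ?h) - w s\<bar> < ?\<eta> / 8" "\<bar>w ?t - l\<bar> < ?\<eta> / 8" using 1 2 by simp_all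
        moreover have "1 / real (Suc j) < ?\<eta> / 2" using j by (simp only: min_less_iff_conj)
        moreover have "?\<eta> / 2 < \<bar>A - B - H\<bar>"
          if "\<bar>A - w s\<bar> < ?\<eta> / 8" "\<bar>B - l\<bar> < ?\<eta> / 8" "0 < H" "H < ?\<eta> / 8" for A B H
        proof -
          have "\<bar>w s - l\<bar> \<le> \<bar>A - B - H\<bar> + \<bar>A - w s\<bar> + \<bar>B - l\<bar> + H"
            using that(3) by (auto simp: abs_if)
          with that show ?thesis by linarith
        qed
        ultimately show ?thesis using h by (meson order_less_trans)
      qed
      moreover have "\<bar>w ?t - a\<bar> \<le> 1 / real (Suc i) \<or> \<bar>w (?t + ?h) - a\<bar> \<le> 1 / real (Suc i)"
        using a 1 2 by auto
      ultimately show "\<exists>k::nat. 1 / real (Suc j) \<le> real k / 2^n \<and> real k / 2^n \<le> real N \<and>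
         1 / real (Suc j) < \<bar>w (real k / 2^n + 1 / 2^n) - w (real k / 2^n) - 1 / 2^n\<bar> \<and>
         (\<bar>w (real k / 2^n) - a\<bar> \<le> 1 / real (Suc i) \<or> \<bar>w (real k / 2^n + 1 / 2^n) - a\<bar> \<le> 1 / real (Suc i))"
        by blast
    qed
  qed
qed

lemma increment_le_dyadic_variation:
  assumes "j \<le> 2^m"
  shows "\<bar>f (s + real j * h / 2^m) - f s\<bar> \<le> dyadic_variation m s h f"
proof -
  let ?g = "\<lambda>i. f (s + real i * h / 2^m)"
  have "\<bar>?g j - ?g 0\<bar> = \<bar>\<Sum>i<j. ?g (Suc i) - ?g i\<bar>" by (subst sum_lessThan_telescope) simp
  also have "\<dots> \<le> (\<Sum>i<j. \<bar>?g (Suc i) - ?g i\<bar>)" by (rule sum_abs)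
  also have "\<dots> \<le> (\<Sum>i<2^m. \<bar>?g (Suc i) - ?g i\<bar>)" using assms by (intro sum_mono2) auto
  finally show ?thesis by (simp add: dyadic_variation_def)
qed

text \<open>
  By right continuity the increment up to \<open>s\<close> is almost that up to the next grid point, and the latter
  telescopes along the grid.
\<close>

lemma dyadic_variation_exceeds:
  assumes z: "cadlag z" and s0: "0 \<le> s0" "s0 \<le> s" "s \<le> s0 + h" and c: "c < \<bar>z s - z s0\<bar>"
  shows "\<exists>m. c < dyadic_variation m s0 h z"
proof (cases "s = s0")
  case True
  then have "c < dyadic_variation 0 s0 h z" using c dyadic_variation_nonneg[of 0 s0 h z] by simp
  then show ?thesis ..
next
  case False
  with s0 have h: "0 < h" "0 < s - s0" by auto
  let ?e = "\<bar>z s - z s0\<bar> - c"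
  obtain d where d: "0 < d" "\<And>y. s \<le> y \<Longrightarrow> y < s + d \<Longrightarrow> \<bar>z y - z s\<bar> < ?e"
    using cadlag_right_nbhd[OF z, of s ?e] s0 c by auto
  obtain m where m: "1 / 2^m < d / h" using ex_small_power[of "d / h"] d h by (metis divide_pos_pos order_refl)
  have hm: "0 < h / 2^m" using h by simp
  obtain k where k: "real k * (h / 2^m) < s - s0" "s - s0 \<le> real (Suc k) * (h / 2^m)"
    using grid_bracket[OF h(2) hm] .
  have "real k * (h / 2^m) < h" using k(1) s0(3) by linarith
  then have "real k < 2^m" using h by (simp add: field_simps)
  then have "k < 2^m" by (metis of_nat_less_iff of_nat_numeral of_nat_power)
  then have "\<bar>z (s0 + real (Suc k) * h / 2^m) - z s0\<bar> \<le> dyadic_variation m s0 h z"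
    by (intro increment_le_dyadic_variation) simp
  moreover have "\<bar>z (s0 + real (Suc k) * h / 2^m) - z s\<bar> < ?e"
  proof (rule d)
    show "s \<le> s0 + real (Suc k) * h / 2^m" using k by simp
    have "real (Suc k) * h / 2^m = real k * (h / 2^m) + h / 2^m" by (simp add: field_simps)
    moreover have "h / 2^m < d" using m h by (simp add: field_simps)
    ultimately show "s0 + real (Suc k) * h / 2^m < s + d" using k(1) by linarith
  qed
  ultimately have "c < dyadic_variation m s0 h z" by linarith
  then show ?thesis ..
qed

lemma cadlag_add_linear:
  assumes "cadlag w" shows "cadlag (\<lambda>t. a + w t + c * t)"
  unfolding cadlag_def
proof (intro conjI allI impI)
  fix t :: real
  show "continuous (at_right t) (\<lambda>t. a + w t + c * t)" if "0 \<le> t"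
    using assms that by (intro continuous_intros) (auto simp: cadlag_def)
  show "\<exists>l. ((\<lambda>t. a + w t + c * t) \<longlongrightarrow> l) (at_left t)" if t: "0 < t"
  proof -
    obtain l where "(w \<longlongrightarrow> l) (at_left t)" using cadlag_left_limit[OF assms t] .
    then have "((\<lambda>t. a + w t + c * t) \<longlongrightarrow> a + l + c * t) (at_left t)" by (intro tendsto_intros)
    then show ?thesis ..
  qed
qed

text \<open>
  This is where the sign of the drift enters. At the left end \<open>t\<close> of the cell of the hitting time \<open>s\<close>,
  \<open>0 < w t = (w t - t) - (w s - s) - (s - t)\<close>, so the increment of the path without drift is at
  least \<open>w t\<close>: the drift cannot help the path to come down.
\<close>

lemma creep_down_near_of_continuous_hit:
  assumes w: "cadlag w" and s: "0 < s" and l: "(w \<longlongrightarrow> 0) (at_left s)" and ws: "w s = 0"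
    and pos: "\<And>t. 0 \<le> t \<Longrightarrow> t < s \<Longrightarrow> 0 < w t"
  shows "creep_down_near w"
proof -
  obtain j where j: "1 / real (Suc j) < s / 2" using ex_inverse_Suc_less[of "s / 2"] s by auto
  obtain N :: nat where N: "s \<le> real N" using real_arch_simple by blast
  show ?thesis
    unfolding creep_down_near_def
  proof (rule exI[of _ j], rule exI[of _ N], rule allI)
    fix i :: nat
    obtain d where d: "0 < d" "\<And>y. s - d < y \<Longrightarrow> y < s \<Longrightarrow> \<bar>w y - 0\<bar> < 1 / real (Suc i)"
      using left_limit_nbhd[OF l, of "1 / real (Suc i)"] by auto
    obtain n0 where n0: "\<And>n. n0 \<le> n \<Longrightarrow> 1 / 2^n < min d (s / 2)"
      using ex_small_power[of "min d (s / 2)"] d(1) s by auto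
    show "\<exists>n0. \<forall>n\<ge>n0. \<exists>k::nat. 1 / real (Suc j) \<le> real k / 2^n \<and> real k / 2^n \<le> real N \<and>
      (\<exists>m. \<bar>w (real k / 2^n)\<bar> \<le> 1 / real (Suc i) \<and>
       \<bar>w (real k / 2^n)\<bar> \<le> 2 * dyadic_variation m (real k / 2^n) (1 / 2^n) (\<lambda>t. w t - t))"
    proof (rule exI[of _ n0], intro allI impI)
      fix n assume n: "n0 \<le> n"
      let ?h = "1 / 2^n :: real"
      have h: "0 < ?h" "?h < d" "?h < s / 2" using n0[OF n] by auto
      obtain k where k: "real k * ?h < s" "s \<le> real (Suc k) * ?h" using grid_bracket[OF s h(1)] .
      let ?t = "real k / 2^n"
      have t: "0 \<le> ?t" "?t < s" "s \<le> ?t + ?h" using k by (simp_all add: field_simps)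
      have small: "\<bar>w ?t\<bar> \<le> 1 / real (Suc i)" using d(2)[of ?t] t h by auto
      have wt: "0 < w ?t" using pos t by simp
      have "w ?t / 2 < \<bar>(w s - s) - (w ?t - ?t)\<bar>" using wt ws t by linarith
      moreover have "cadlag (\<lambda>t. w t - t)" using cadlag_add_linear[OF w, of 0 "-1"] by simp
      ultimately obtain m where "w ?t / 2 < dyadic_variation m ?t ?h (\<lambda>t. w t - t)"
        using dyadic_variation_exceeds[of "\<lambda>t. w t - t" ?t s ?h "w ?t / 2"] t by auto
      then have "\<bar>w ?t\<bar> \<le> 2 * dyadic_variation m ?t ?h (\<lambda>t. w t - t)" using wt by linarith
      moreover have "1 / real (Suc j) \<le> ?t" "?t \<le> real N" using t h j N by auto
      ultimately show "\<exists>k::nat. 1 / real (Suc j) \<le> real k / 2^n \<and> real k / 2^n \<le> real N \<and>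
        (\<exists>m. \<bar>w (real k / 2^n)\<bar> \<le> 1 / real (Suc i) \<and>
         \<bar>w (real k / 2^n)\<bar> \<le> 2 * dyadic_variation m (real k / 2^n) (1 / 2^n) (\<lambda>t. w t - t))"
        using small by blast
    qed
  qed
qed

lemma exit_time_eq:
  assumes "0 \<le> T" "w T \<notin> D" "\<And>t. 0 \<le> t \<Longrightarrow> t < T \<Longrightarrow> w t \<in> D"
  shows "exit_time D w = ennreal T"
  unfolding exit_time_def
proof (rule antisym)
  show "(INF t\<in>{t. 0 \<le> t \<and> w t \<notin> D}. ennreal t) \<le> ennreal T" by (rule INF_lower) (use assms in simp)
  show "ennreal T \<le> (INF t\<in>{t. 0 \<le> t \<and> w t \<notin> D}. ennreal t)"
    using assms(3) by (intro INF_greatest ennreal_leI) (use not_less in blast)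
qed

text \<open>
  The infimum of the times outside \<open>D\<close> is attained, because the complement of \<open>D\<close> is closed and the path
  is right continuous.
\<close>

lemma first_exit:
  assumes w: "cadlag w" and D: "open D" and t: "0 \<le> t" "w t \<notin> D"
  obtains T where "0 \<le> T" "T \<le> t" "w T \<notin> D" "\<And>u. 0 \<le> u \<Longrightarrow> u < T \<Longrightarrow> w u \<in> D"
proof -
  let ?S = "{u. 0 \<le> u \<and> w u \<notin> D}"
  define T where "T = Inf ?S"
  have bdd: "bdd_below ?S" and ne: "?S \<noteq> {}" using t by (auto intro: bdd_belowI[of _ 0])
  have T0: "0 \<le> T" unfolding T_def using ne by (intro cInf_greatest) auto
  have "T \<le> t" unfolding T_def using t bdd by (intro cInf_lower) auto
  moreover have "w u \<in> D" if "0 \<le> u" "u < T" for u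
  proof (rule ccontr)
    assume "w u \<notin> D"
    then have "T \<le> u" unfolding T_def using that(1) bdd by (intro cInf_lower) auto
    with that(2) show False by simp
  qed
  moreover have "w T \<notin> D"
  proof
    assume "w T \<in> D"
    then obtain e where e: "0 < e" "ball (w T) e \<subseteq> D" using D by (auto simp: open_contains_ball)
    obtain d where d: "0 < d" "\<And>y. T \<le> y \<Longrightarrow> y < T + d \<Longrightarrow> \<bar>w y - w T\<bar> < e"
      using cadlag_right_nbhd[OF w T0 e(1)] by blast
    have "Inf ?S < T + d" using d(1) by (simp add: T_def)
    then obtain u where u: "u \<in> ?S" "u < T + d" using cInf_less_iff[OF ne bdd] by blast
    moreover have "T \<le> u" unfolding T_def using u(1) bdd by (intro cInf_lower) auto
    ultimately have "w u \<in> D" using d(2)[of u] e(2) by (auto simp: dist_real_def subset_iff)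
    with u(1) show False by simp
  qed
  ultimately show thesis using T0 that by blast
qed

lemma exits_at_iff:
  assumes "open D" and w: "w \<in> space path_space" and a: "a \<notin> D"
  shows "w \<in> exits_at D a \<longleftrightarrow> (\<exists>T\<ge>0. w T = a \<and> (\<forall>t. 0 \<le> t \<longrightarrow> t < T \<longrightarrow> w t \<in> D))"
proof
  assume ex: "w \<in> exits_at D a"
  have cad: "cadlag w" using w by (simp add: path_space_def space_restrict_space)
  have "{t. 0 \<le> t \<and> w t \<notin> D} \<noteq> {}"
  proof
    assume "{t. 0 \<le> t \<and> w t \<notin> D} = {}"
    then have "exit_time D w = \<infinity>" by (simp add: exit_time_def)
    with ex show False by (simp add: exits_at_def)
  qed
  then obtain t where "0 \<le> t" "w t \<notin> D" by auto
  from first_exit[OF cad \<open>open D\<close> this] obtain T where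
    T: "0 \<le> T" "w T \<notin> D" "\<And>u. 0 \<le> u \<Longrightarrow> u < T \<Longrightarrow> w u \<in> D" by metis
  then have "exit_time D w = ennreal T" by (intro exit_time_eq)
  then have "w T = a" using ex T(1) by (simp add: exits_at_def)
  with T show "\<exists>T\<ge>0. w T = a \<and> (\<forall>t. 0 \<le> t \<longrightarrow> t < T \<longrightarrow> w t \<in> D)" by blast
next
  assume "\<exists>T\<ge>0. w T = a \<and> (\<forall>t. 0 \<le> t \<longrightarrow> t < T \<longrightarrow> w t \<in> D)"
  then obtain T where T: "0 \<le> T" "w T = a" "\<forall>t. 0 \<le> t \<longrightarrow> t < T \<longrightarrow> w t \<in> D" by blast
  then have "exit_time D w = ennreal T" using a by (intro exit_time_eq) auto
  then show "w \<in> exits_at D a" using T w by (simp add: exits_at_def)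
qed

lemma exits_at_0_imp_near:
  assumes w: "w \<in> space path_space" and w0: "w 0 \<in> {0<..<1}" and ex: "w \<in> exits_at {0<..<1} 0"
  shows "jump_near 0 w \<or> creep_down_near w"
proof -
  have cad: "cadlag w" using w by (simp add: path_space_def space_restrict_space)
  obtain T where T: "0 \<le> T" "w T = 0" "\<And>t. 0 \<le> t \<Longrightarrow> t < T \<Longrightarrow> w t \<in> {0<..<1}"
    using ex exits_at_iff[OF _ w, of "{0<..<1}" 0] by auto
  then have T0: "0 < T" using w0 by (cases "T = 0") auto
  obtain l where l: "(w \<longlongrightarrow> l) (at_left T)" using cadlag_left_limit[OF cad T0] .
  show ?thesis
  proof (cases "l = w T")
    case True
    then have "creep_down_near w"
      using l T T0 by (intro creep_down_near_of_continuous_hit[OF cad T0]) auto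
    then show ?thesis ..
  next
    case False
    then have "jump_near 0 w" using T by (intro jump_near_of_jump[OF cad T0 l]) auto
    then show ?thesis ..
  qed
qed

section \<open>Exit through the upper end point\<close>

text \<open>
  An event determined by the values at rational times: before time \<open>N\<close> the path comes arbitrarily close
  to \<open>1\<close> while its past up to that moment stays inside a compact part of the open unit interval.
\<close>

definition approaches_one :: "(real \<Rightarrow> real) \<Rightarrow> bool" where
  "approaches_one w \<longleftrightarrow> (\<exists>N::nat. \<forall>n::nat. \<exists>q::rat. 0 \<le> q \<and> real_of_rat q \<le> real N \<and>
     1 - 1 / real (Suc n) < w (real_of_rat q) \<and>
     (\<exists>m::nat. \<forall>r::rat. 0 \<le> r \<longrightarrow> r \<le> q \<longrightarrow>
        1 / real (Suc m) \<le> w (real_of_rat r) \<and> w (real_of_rat r) \<le> 1 - 1 / real (Suc m)))"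

lemma cadlag_bounds_from_rationals:
  assumes w: "cadlag w" and t: "0 \<le> t" "t < q"
    and r: "\<And>r::rat. 0 \<le> r \<Longrightarrow> real_of_rat r < q \<Longrightarrow> lo \<le> w (real_of_rat r) \<and> w (real_of_rat r) \<le> hi"
  shows "lo \<le> w t \<and> w t \<le> hi"
proof -
  have "lo - e \<le> w t \<and> w t \<le> hi + e" if e: "0 < e" for e
  proof -
    obtain d where d: "0 < d" "\<And>y. t \<le> y \<Longrightarrow> y < t + d \<Longrightarrow> \<bar>w y - w t\<bar> < e"
      using cadlag_right_nbhd[OF w t(1) e] by blast
    obtain r :: rat where "t < real_of_rat r" "real_of_rat r < min (t + d) q"
      using of_rat_dense[of t "min (t + d) q"] d t by auto
    then have *: "t \<le> real_of_rat r" "real_of_rat r < t + d" "real_of_rat r < q" by auto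
    then have "0 \<le> r" using t(1) by (metis order_trans zero_le_of_rat_iff)
    then show ?thesis using r[of r] d(2)[of "real_of_rat r"] * by auto
  qed
  then show ?thesis
    by (meson field_le_epsilon diff_le_eq)
qed

text \<open>
  Near each time the path takes values close to its value or to its left limit there, both of which have
  positive distance from \<open>0\<close> and \<open>1\<close>; compactness of the time interval makes the distance uniform.
\<close>

lemma cadlag_compact_in_unit_interval:
  assumes w: "cadlag w" and q: "0 \<le> q"
    and inside: "\<And>t. 0 \<le> t \<Longrightarrow> t \<le> q \<Longrightarrow> w t \<in> {0<..<1}"
    and left: "\<And>t l. 0 < t \<Longrightarrow> t \<le> q \<Longrightarrow> (w \<longlongrightarrow> l) (at_left t) \<Longrightarrow> l \<in> {0<..<1}"
  shows "\<exists>m::nat. \<forall>t. 0 \<le> t \<longrightarrow> t \<le> q \<longrightarrow> 1 / real (Suc m) \<le> w t \<and> w t \<le> 1 - 1 / real (Suc m)"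
proof -
  have margin: "\<exists>m::nat. 1 / real (Suc m) \<le> x - e \<and> x + e \<le> 1 - 1 / real (Suc m)"
    if "0 < x - e" "x + e < 1" for x e :: real
  proof -
    have "0 < min (x - e) (1 - (x + e))" using that by simp
    then obtain m where "1 / real (Suc m) < min (x - e) (1 - (x + e))"
      using ex_inverse_Suc_less by blast
    then have "1 / real (Suc m) < x - e" "1 / real (Suc m) < 1 - (x + e)"
      by (simp_all only: min_less_iff_conj)
    then show ?thesis by (intro exI[of _ m]) linarith
  qed
  let ?P = "\<lambda>a b. \<exists>m::nat. \<forall>t. 0 \<le> t \<longrightarrow> a \<le> t \<longrightarrow> t \<le> b \<longrightarrow> 1 / real (Suc m) \<le> w t \<and> w t \<le> 1 - 1 / real (Suc m)"
  have weaken: "1 / real (Suc (max m n)) \<le> 1 / real (Suc m)" "1 / real (Suc (max m n)) \<le> 1 / real (Suc n)" for m n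
    by (intro divide_left_mono; simp)+
  have "?P 0 q"
  proof (rule Bolzano[where P = ?P, OF q])
    fix a b c :: real
    assume trans: "?P a b" "?P b c"
    from trans(1) obtain m where m: "\<And>t. 0 \<le> t \<Longrightarrow> a \<le> t \<Longrightarrow> t \<le> b \<Longrightarrow> 1 / real (Suc m) \<le> w t \<and> w t \<le> 1 - 1 / real (Suc m)" by blast
    from trans(2) obtain n where n: "\<And>t. 0 \<le> t \<Longrightarrow> b \<le> t \<Longrightarrow> t \<le> c \<Longrightarrow> 1 / real (Suc n) \<le> w t \<and> w t \<le> 1 - 1 / real (Suc n)" by blast
    show "?P a c"
    proof (intro exI[of _ "max m n"] allI impI)
      fix t assume t: "0 \<le> t" "a \<le> t" "t \<le> c"
      show "1 / real (Suc (max m n)) \<le> w t \<and> w t \<le> 1 - 1 / real (Suc (max m n))"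
        using m[OF t(1,2)] n[OF t(1) _ t(3)] weaken[of m n] by linarith
    qed
  next
    fix x :: real
    assume local: "0 \<le> x" "x \<le> q"
    define e1 where "e1 = min (w x) (1 - w x) / 2"
    have e1: "0 < e1" "0 < w x - e1" "w x + e1 < 1" using inside[of x] local by (auto simp: e1_def min_def field_simps)
    obtain d1 where d1: "0 < d1" "\<And>y. x \<le> y \<Longrightarrow> y < x + d1 \<Longrightarrow> \<bar>w y - w x\<bar> < e1"
      using cadlag_right_nbhd[OF w _ e1(1), of x] local by blast
    obtain m1 where m1: "1 / real (Suc m1) \<le> w x - e1" "w x + e1 \<le> 1 - 1 / real (Suc m1)" using margin e1 by blast
    have "\<exists>d2>0. \<exists>m2::nat. \<forall>y. 0 \<le> y \<longrightarrow> x - d2 < y \<longrightarrow> y < x \<longrightarrow> 1 / real (Suc m2) \<le> w y \<and> w y \<le> 1 - 1 / real (Suc m2)"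
    proof (cases "x = 0")
      case True
      then show ?thesis by (intro exI[of _ 1]) auto
    next
      case False
      then have x: "0 < x" using local by simp
      obtain l where l: "(w \<longlongrightarrow> l) (at_left x)" using cadlag_left_limit[OF w x] .
      define e2 where "e2 = min l (1 - l) / 2"
      have e2: "0 < e2" "0 < l - e2" "l + e2 < 1" using left[OF x _ l] local by (auto simp: e2_def min_def field_simps)
      obtain d2 where d2: "0 < d2" "\<And>y. x - d2 < y \<Longrightarrow> y < x \<Longrightarrow> \<bar>w y - l\<bar> < e2"
        using left_limit_nbhd[OF l e2(1)] by blast
      obtain m2 where m2: "1 / real (Suc m2) \<le> l - e2" "l + e2 \<le> 1 - 1 / real (Suc m2)" using margin e2 by blast
      show ?thesis
      proof (intro exI[of _ d2] conjI exI[of _ m2] allI impI d2(1))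
        fix y assume "x - d2 < y" "y < x"
        then have "\<bar>w y - l\<bar> < e2" by (rule d2(2))
        then show "1 / real (Suc m2) \<le> w y" "w y \<le> 1 - 1 / real (Suc m2)" using m2 by linarith+
      qed
    qed
    then obtain d2 m2 where d2: "0 < d2" and
      m2: "\<And>y. 0 \<le> y \<Longrightarrow> x - d2 < y \<Longrightarrow> y < x \<Longrightarrow> 1 / real (Suc m2) \<le> w y \<and> w y \<le> 1 - 1 / real (Suc m2)" by blast
    show "\<exists>d>0. \<forall>a b. a \<le> x \<and> x \<le> b \<and> b - a < d \<longrightarrow> ?P a b"
    proof (intro exI[of _ "min d1 d2"] conjI allI impI)
      show "0 < min d1 d2" using d1(1) d2 by simp
      fix a b assume ab: "a \<le> x \<and> x \<le> b \<and> b - a < min d1 d2"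
      show "?P a b"
      proof (intro exI[of _ "max m1 m2"] allI impI)
        fix t assume t: "0 \<le> t" "a \<le> t" "t \<le> b"
        show "1 / real (Suc (max m1 m2)) \<le> w t \<and> w t \<le> 1 - 1 / real (Suc (max m1 m2))"
        proof (cases "t < x")
          case True
          then show ?thesis using m2[OF t(1)] t ab weaken[of m1 m2] by auto
        next
          case False
          then have "\<bar>w t - w x\<bar> < e1" using t ab by (intro d1) auto
          then show ?thesis using m1 weaken[of m1 m2] by linarith
        qed
      qed
    qed
  qed
  then show ?thesis by simp
qed

text \<open>
  Without a jump from \<open>0\<close> or \<open>1\<close> the left limits before the exit time lie in the open interval, so the
  past is confined to a compact part of it; without a jump onto \<open>1\<close> the left limit at the exit time
  is \<open>1\<close>.
\<close>

lemma exits_at_1_imp_approaches_one: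
  assumes w: "w \<in> space path_space" and w0: "w 0 \<in> {0<..<1}" and ex: "w \<in> exits_at {0<..<1} 1"
    and nj: "\<not> jump_near 0 w" "\<not> jump_near 1 w"
  shows "approaches_one w"
proof -
  have cad: "cadlag w" using w by (simp add: path_space_def space_restrict_space)
  obtain T where T: "0 \<le> T" "w T = 1" "\<And>t. 0 \<le> t \<Longrightarrow> t < T \<Longrightarrow> w t \<in> {0<..<1}"
    using ex exits_at_iff[OF _ w, of "{0<..<1}" 1] by auto
  then have T0: "0 < T" using w0 by (cases "T = 0") auto
  have left: "l \<in> {0<..<1}" if t: "0 < t" "t < T" and l: "(w \<longlongrightarrow> l) (at_left t)" for t l
  proof -
    have ev: "eventually (\<lambda>u. w u \<in> {0<..<1}) (at_left t)"
      unfolding eventually_at_left_field using t T(3) by (intro exI[of _ 0]) auto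
    have "0 \<le> l" by (rule tendsto_lowerbound[OF l]) (use ev in \<open>auto elim: eventually_mono\<close>)
    moreover have "l \<le> 1" by (rule tendsto_upperbound[OF l]) (use ev in \<open>auto elim: eventually_mono\<close>)
    moreover have "l \<noteq> 0" "l \<noteq> 1"
      using jump_near_of_jump[OF cad t(1) l] nj T(3)[of t] t by force+
    ultimately show ?thesis by simp
  qed
  obtain l where l: "(w \<longlongrightarrow> l) (at_left T)" using cadlag_left_limit[OF cad T0] .
  have l1: "l = 1" using jump_near_of_jump[OF cad T0 l, of 1] nj T(2) by auto
  obtain N :: nat where N: "T \<le> real N" using real_arch_simple by blast
  show ?thesis
    unfolding approaches_one_def
  proof (intro exI[of _ N] allI)
    fix n :: nat
    obtain d where d: "0 < d" "\<And>y. T - d < y \<Longrightarrow> y < T \<Longrightarrow> \<bar>w y - 1\<bar> < 1 / real (Suc n)"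
      using left_limit_nbhd[OF l[unfolded l1], of "1 / real (Suc n)"] by auto
    obtain q :: rat where q: "max 0 (T - d) < real_of_rat q" "real_of_rat q < T"
      using of_rat_dense[of "max 0 (T - d)" T] T0 d(1) by auto
    then have q0: "0 \<le> real_of_rat q" "0 \<le> q" by auto
    obtain m where m: "\<And>t. 0 \<le> t \<Longrightarrow> t \<le> real_of_rat q \<Longrightarrow> 1 / real (Suc m) \<le> w t \<and> w t \<le> 1 - 1 / real (Suc m)"
      using cadlag_compact_in_unit_interval[OF cad q0(1)] T(3) left q(2) by (metis order_le_less_trans)
    show "\<exists>q::rat. 0 \<le> q \<and> real_of_rat q \<le> real N \<and> 1 - 1 / real (Suc n) < w (real_of_rat q) \<and>
     (\<exists>m::nat. \<forall>r::rat. 0 \<le> r \<longrightarrow> r \<le> q \<longrightarrow>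
        1 / real (Suc m) \<le> w (real_of_rat r) \<and> w (real_of_rat r) \<le> 1 - 1 / real (Suc m))"
    proof (intro exI[of _ q] conjI)
      show "0 \<le> q" by fact
      show "real_of_rat q \<le> real N" using q N by linarith
      show "1 - 1 / real (Suc n) < w (real_of_rat q)" using d(2)[of "real_of_rat q"] q by auto
      show "\<exists>m::nat. \<forall>r::rat. 0 \<le> r \<longrightarrow> r \<le> q \<longrightarrow>
        1 / real (Suc m) \<le> w (real_of_rat r) \<and> w (real_of_rat r) \<le> 1 - 1 / real (Suc m)"
        using m by (intro exI[of _ m]) (auto simp: of_rat_less_eq)
    qed
  qed
qed

text \<open>
  The exit time is the supremum \<open>T\<close> of the rational times that witness the approach to \<open>1\<close>. It exceeds
  each of them, because the past of each is bounded away from \<open>1\<close>, and the left limit at \<open>T\<close> is \<open>1\<close>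
  because the witnesses accumulate only at \<open>T\<close>. Without a jump from \<open>1\<close> the value at \<open>T\<close> is \<open>1\<close>, too.
\<close>

lemma approaches_one_imp_exits_at_1:
  assumes w: "w \<in> space path_space" and ap: "approaches_one w" and nj: "\<not> jump_near 1 w"
  shows "w \<in> exits_at {0<..<1} 1"
proof -
  have cad: "cadlag w" using w by (simp add: path_space_def space_restrict_space)
  obtain N q m where q: "\<And>n::nat. 0 \<le> q n" "\<And>n. real_of_rat (q n) \<le> real N"
      "\<And>n. 1 - 1 / real (Suc n) < w (real_of_rat (q n))"
    and m: "\<And>n r. 0 \<le> r \<Longrightarrow> r \<le> q n \<Longrightarrow>
        1 / real (Suc (m n)) \<le> w (real_of_rat r) \<and> w (real_of_rat r) \<le> 1 - 1 / real (Suc (m n))"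
    using ap unfolding approaches_one_def by metis
  let ?q = "\<lambda>n. real_of_rat (q n)"
  define T where "T = (SUP n. ?q n)"
  have bdd: "bdd_above (range ?q)" using q(2) by (intro bdd_aboveI[of _ "real N"]) auto
  have qT: "?q n \<le> T" for n unfolding T_def using bdd by (intro cSUP_upper) auto
  \<comment> \<open>The bound on the past of \<open>q n\<close> rules out the value of the path at \<open>q (m n)\<close>.\<close>
  have beyond: "\<exists>k. ?q n < ?q k" for n
  proof -
    have "w (?q (m n)) > 1 - 1 / real (Suc (m n))" by (rule q(3))
    then have "\<not> q (m n) \<le> q n" using m[OF q(1), of "m n" n] by linarith
    then show ?thesis by (metis not_le of_rat_less)
  qed
  have qT': "?q n < T" for n using beyond[of n] qT by (metis order_less_le_trans)
  have T0: "0 < T" using qT'[of 0] q(1)[of 0] by (meson order_le_less_trans zero_le_of_rat_iff)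
  have below: "\<exists>n. t < ?q n" if "t < T" for t
    using that unfolding T_def by (subst (asm) less_cSUP_iff[OF _ bdd]) auto
  have bounds: "1 / real (Suc (m n)) \<le> w t \<and> w t \<le> 1 - 1 / real (Suc (m n))" if "0 \<le> t" "t < ?q n" for t n
    by (rule cadlag_bounds_from_rationals[OF cad that]) (use m in \<open>auto simp: of_rat_less\<close>)
  have inside: "w t \<in> {0<..<1}" if t: "0 \<le> t" "t < T" for t
  proof -
    obtain n where "t < ?q n" using below t(2) by blast
    moreover have "0 < 1 / real (Suc (m n))" by simp
    ultimately have "0 < w t" "w t < 1" using bounds[OF t(1), of n] by linarith+
    then show ?thesis by simp
  qed
  obtain l where l: "(w \<longlongrightarrow> l) (at_left T)" using cadlag_left_limit[OF cad T0] .
  have "eventually (\<lambda>u. w u \<le> 1) (at_left T)"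
    unfolding eventually_at_left_field using T0 inside by (intro exI[of _ 0]) (auto intro: less_imp_le)
  then have "l \<le> 1" by (intro tendsto_upperbound[OF l]) auto
  moreover have "\<not> l < 1"
  proof
    assume "l < 1"
    then have e: "0 < (1 - l) / 2" by simp
    obtain d where d: "0 < d" "\<And>y. T - d < y \<Longrightarrow> y < T \<Longrightarrow> \<bar>w y - l\<bar> < (1 - l) / 2"
      using left_limit_nbhd[OF l e] by blast
    obtain n where n: "T - d < ?q n" using below[of "T - d"] d(1) by auto
    obtain k where k: "1 / real (Suc k) < min ((1 - l) / 2) (1 / real (Suc (m n)))"
      using ex_inverse_Suc_less[of "min ((1 - l) / 2) (1 / real (Suc (m n)))"] e by auto
    have wk: "1 - 1 / real (Suc k) < w (?q k)" by (rule q(3))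
    show False
    proof (cases "q k \<le> q n")
      case True
      then show False using m[OF q(1) True] wk k by linarith
    next
      case False
      then have "?q n < ?q k" by (simp add: of_rat_less)
      then have "\<bar>w (?q k) - l\<bar> < (1 - l) / 2" using n qT' by (intro d) auto
      then have "w (?q k) < l + (1 - l) / 2" by (simp only: abs_less_iff less_diff_eq diff_less_eq add.commute)
      moreover have "1 / real (Suc k) < (1 - l) / 2" using k by (simp only: min_less_iff_conj)
      ultimately have "1 < l + ((1 - l) / 2 + (1 - l) / 2)" using wk by linarith
      then show False by (simp add: field_simps)
    qed
  qed
  ultimately have "l = 1" by simp
  then have "w T = 1" using jump_near_of_jump[OF cad T0 l, of 1] nj by auto
  then show ?thesis using inside T0 by (subst exits_at_iff[OF _ w]) (auto intro!: exI[of _ T])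
qed

text \<open>
  Trace on the dyadic grids of \<open>[0, T]\<close> of an upward jump across the level \<open>a\<close>. The last condition says
  that in the crossing cell the increment without drift is at least the mesh \<open>T / 2 ^ n\<close>. A jump
  meets it on fine grids, and it forces the full increment to be at most twice the increment without drift.
\<close>

definition jumps_over :: "real \<Rightarrow> real \<Rightarrow> (real \<Rightarrow> real) \<Rightarrow> bool" where
  "jumps_over T a w \<longleftrightarrow> (\<exists>n0. \<forall>n\<ge>n0. \<exists>k<(2::nat)^n.
     w (real k * (T / 2^n)) < a \<and> a < w (real (Suc k) * (T / 2^n)) \<and>
     T / 2^n \<le> \<bar>w (real (Suc k) * (T / 2^n)) - w (real k * (T / 2^n)) - T / 2^n\<bar>)"

lemma jumps_over_of_jump:
  assumes w: "cadlag w" and s: "0 < s" "s \<le> T" and l: "(w \<longlongrightarrow> l) (at_left s)" and a: "l < a" "a < w s"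
  shows "jumps_over T a w"
proof -
  let ?e = "min (a - l) (w s - a) / 2"
  have e: "0 < ?e" using a by simp
  have T: "0 < T" using s by simp
  obtain d1 where d1: "0 < d1" "\<And>y. s \<le> y \<Longrightarrow> y < s + d1 \<Longrightarrow> \<bar>w y - w s\<bar> < ?e"
    using cadlag_right_nbhd[OF w _ e, of s] s by auto
  obtain d2 where d2: "0 < d2" "\<And>y. s - d2 < y \<Longrightarrow> y < s \<Longrightarrow> \<bar>w y - l\<bar> < ?e"
    using left_limit_nbhd[OF l e] by auto
  let ?d = "min (min d1 d2) (min (a - l) (w s - a) / 2)"
  obtain n0 where n0: "\<And>n. n0 \<le> n \<Longrightarrow> 1 / 2^n < ?d / T"
    using ex_small_power[of "?d / T"] d1(1) d2(1) e T by (metis divide_pos_pos min_less_iff_conj)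
  show ?thesis
    unfolding jumps_over_def
  proof (rule exI[of _ n0], intro allI impI)
    fix n assume n: "n0 \<le> n"
    let ?h = "T / 2^n"
    have h0: "0 < ?h" using T by simp
    have "?h < ?d" using n0[OF n] T by (simp add: field_simps)
    then have h: "?h < d1" "?h < d2" "?h < ?e" by (simp_all only: min_less_iff_conj)
    obtain k where k: "real k * ?h < s" "s \<le> real (Suc k) * ?h" using grid_bracket[OF s(1) h0] .
    have Sk: "real (Suc k) * ?h = real k * ?h + ?h" by (simp add: field_simps)
    have "real k * ?h < T" using k(1) s(2) by linarith
    then have "real k < 2^n" using T by (simp add: field_simps)
    then have "k < 2^n" by (metis of_nat_less_iff of_nat_numeral of_nat_power)
    moreover have 1: "\<bar>w (real (Suc k) * ?h) - w s\<bar> < ?e" using k h Sk by (intro d1) linarith+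
    moreover have 2: "\<bar>w (real k * ?h) - l\<bar> < ?e" using k h Sk by (intro d2) linarith+
    moreover have "x < a \<and> a < y \<and> H \<le> \<bar>y - x - H\<bar>"
      if "\<bar>y - w s\<bar> < ?e" "\<bar>x - l\<bar> < ?e" "H < ?e" for x y H
    proof -
      have "?e \<le> (a - l) / 2" "?e \<le> (w s - a) / 2" by simp_all
      moreover have "x - l \<le> \<bar>x - l\<bar>" "w s - y \<le> \<bar>y - w s\<bar>" by simp_all
      ultimately have *: "H < (a - l) / 2" "H < (w s - a) / 2" "x - l < (a - l) / 2" "w s - y < (w s - a) / 2"
        using that by (meson order_le_less_trans order_less_le_trans)+
      then have "x < a - (a - l) / 2" "a + (w s - a) / 2 < y" by (simp_all add: field_simps)
      moreover have "0 < (a - l) / 2" "0 < (w s - a) / 2" using a by simp_all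
      moreover have "x < a \<and> a < y \<and> H \<le> \<bar>y - x - H\<bar>"
        if "0 < p" "0 < r" "H < p" "H < r" "x < a - p" "a + r < y" for p r
        using that by linarith
      ultimately show ?thesis using *(1,2) by blast
    qed
    ultimately show "\<exists>k<(2::nat)^n. w (real k * ?h) < a \<and> a < w (real (Suc k) * ?h) \<and>
      ?h \<le> \<bar>w (real (Suc k) * ?h) - w (real k * ?h) - ?h\<bar>"
      using h by blast
  qed
qed

text \<open>
  At the first exit the path is at or above \<open>1\<close>. Exceeding \<open>1\<close> would mean a jump with left limit at most
  \<open>1\<close>, which starts exactly at \<open>1\<close> or crosses \<open>1\<close> from strictly below; the hypotheses exclude both.
\<close>

lemma exits_at_1_of_no_jump:
  assumes w: "w \<in> space path_space" and w0: "w 0 < 1" and T: "0 \<le> T" "1 \<le> w T"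
    and pos: "\<And>t. 0 \<le> t \<Longrightarrow> t \<le> T \<Longrightarrow> 0 < w t"
    and nj: "\<not> jumps_over T 1 w" "\<not> jump_near 1 w"
  shows "w \<in> exits_at {0<..<1} 1"
proof -
  have cad: "cadlag w" using w by (simp add: path_space_def space_restrict_space)
  obtain s where s: "0 \<le> s" "s \<le> T" "w s \<notin> {0<..<1}" "\<And>u. 0 \<le> u \<Longrightarrow> u < s \<Longrightarrow> w u \<in> {0<..<1}"
    using first_exit[OF cad _ T(1), of "{0<..<1}"] T(2) by (auto simp: not_less)
  have ws: "1 \<le> w s" using s(3) pos[OF s(1,2)] by auto
  then have s0: "0 < s" using w0 s(1) by (cases "s = 0") auto
  obtain l where l: "(w \<longlongrightarrow> l) (at_left s)" using cadlag_left_limit[OF cad s0] .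
  have "eventually (\<lambda>u. w u \<le> 1) (at_left s)"
    unfolding eventually_at_left_field using s0 s(4) by (intro exI[of _ 0]) (auto intro: less_imp_le)
  then have l1: "l \<le> 1" by (intro tendsto_upperbound[OF l]) auto
  have "w s = 1"
  proof (rule ccontr)
    assume "w s \<noteq> 1"
    then have "1 < w s" using ws by simp
    moreover from this have "l \<noteq> 1" using jump_near_of_jump[OF cad s0 l, of 1] nj(2) by auto
    ultimately show False using jumps_over_of_jump[OF cad s0 s(2) l, of 1] l1 nj(1) by auto
  qed
  then show ?thesis using s by (subst exits_at_iff[OF _ w]) (auto intro!: exI[of _ s])
qed

section \<open>Measurability on the path space\<close>

lemma dyadic_variation_cong:
  assumes "0 \<le> s" "0 \<le> h" "\<And>t. 0 \<le> t \<Longrightarrow> f t = g t"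
  shows "dyadic_variation m s h f = dyadic_variation m s h g"
  unfolding dyadic_variation_def using assms by (intro sum.cong refl) simp

text \<open>
  Used to pass from the process, defined for all real times, to its extensional restriction to
  nonnegative times, which is the canonical path.
\<close>

lemma cadlag_cong:
  assumes f: "cadlag f" and eq: "\<And>t. 0 \<le> t \<Longrightarrow> f t = g t"
  shows "cadlag g"
  unfolding cadlag_def
proof (intro conjI allI impI)
  fix t :: real assume t: "0 \<le> t"
  have "eventually (\<lambda>u. f u = g u) (at_right t)"
    unfolding eventually_at_right_field using t eq by (intro exI[of _ "t + 1"]) auto
  moreover have "(f \<longlongrightarrow> f t) (at_right t)" using f t by (auto simp: cadlag_def continuous_within)
  ultimately show "continuous (at_right t) g"
    using eq[OF t] by (auto simp: continuous_within elim: Lim_transform_eventually[rotated])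
next
  fix t :: real assume t: "0 < t"
  have "eventually (\<lambda>u. f u = g u) (at_left t)"
    unfolding eventually_at_left_field using t eq by (intro exI[of _ 0]) auto
  moreover obtain l where "(f \<longlongrightarrow> l) (at_left t)" using cadlag_left_limit[OF f t] .
  ultimately have "(g \<longlongrightarrow> l) (at_left t)" by (rule Lim_transform_eventually[rotated])
  then show "\<exists>l. (g \<longlongrightarrow> l) (at_left t)" ..
qed

lemma space_path_space_cadlag: "w \<in> space path_space \<Longrightarrow> cadlag w"
  by (simp add: path_space_def space_restrict_space)

lemma coordinate_measurable:
  "0 \<le> t \<Longrightarrow> (\<lambda>w. w t) \<in> borel_measurable path_space"
  unfolding path_space_def
  by (intro measurable_restrict_space1 measurable_component_singleton) simp

lemma jump_near_measurable [measurable]: "Measurable.pred path_space (jump_near a)"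
proof -
  have *: "Measurable.pred N (\<lambda>w. e < \<bar>f w - g w - h\<bar> \<and> (\<bar>g w - a\<bar> \<le> d \<or> \<bar>f w - a\<bar> \<le> d))"
    if [measurable]: "f \<in> borel_measurable N" "g \<in> borel_measurable N"
    for f g :: "'b \<Rightarrow> real" and N e d h
    by measurable
  show ?thesis
    unfolding jump_near_def
    by (intro pred_intros_countable pred_intros_imp' pred_intros_conj1' * coordinate_measurable) simp_all
qed

lemma path_variation_measurable:
  assumes "0 \<le> s" "0 \<le> h"
  shows "(\<lambda>w. dyadic_variation m s h (\<lambda>t. w t - t)) \<in> borel_measurable path_space"
  unfolding dyadic_variation_def using assms
  by (intro borel_measurable_sum borel_measurable_abs borel_measurable_diff coordinate_measurable) auto

lemma creep_down_near_measurable [measurable]: "Measurable.pred path_space creep_down_near"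
proof -
  have *: "Measurable.pred N (\<lambda>w. \<bar>f w\<bar> \<le> d \<and> \<bar>f w\<bar> \<le> 2 * g w)"
    if [measurable]: "f \<in> borel_measurable N" "g \<in> borel_measurable N"
    for f g :: "'b \<Rightarrow> real" and N d
    by measurable
  show ?thesis
    unfolding creep_down_near_def
    by (intro pred_intros_countable pred_intros_imp' pred_intros_conj1' * coordinate_measurable
        path_variation_measurable) simp_all
qed

lemma approaches_one_measurable [measurable]: "Measurable.pred path_space approaches_one"
proof -
  have 1: "Measurable.pred N (\<lambda>w. c < f w)" if [measurable]: "f \<in> borel_measurable N"
    for f :: "'b \<Rightarrow> real" and N c
    by measurable
  have 2: "Measurable.pred N (\<lambda>w. c \<le> f w \<and> f w \<le> d)" if [measurable]: "f \<in> borel_measurable N"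
    for f :: "'b \<Rightarrow> real" and N c d
    by measurable
  have 3: "Measurable.pred N (\<lambda>w. P w \<and> Q w)" if "Measurable.pred N P" "Measurable.pred N Q"
    for P Q :: "'b \<Rightarrow> bool" and N
    using that by measurable
  show ?thesis
    unfolding approaches_one_def
    by (intro pred_intros_countable pred_intros_imp' pred_intros_conj1' 3[OF 1] 2 coordinate_measurable) simp_all
qed

lemma jump_near_cong:
  assumes "\<And>t. 0 \<le> t \<Longrightarrow> f t = g t" shows "jump_near a f = jump_near a g"
proof -
  have "f (real k / 2^n) = g (real k / 2^n)" "f (real k / 2^n + 1 / 2^n) = g (real k / 2^n + 1 / 2^n)" for k n :: nat
    by (simp_all add: assms)
  then show ?thesis unfolding jump_near_def by (simp only:)
qed

lemma creep_down_near_cong: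
  assumes eq: "\<And>t. 0 \<le> t \<Longrightarrow> f t = g t" shows "creep_down_near f = creep_down_near g"
proof -
  have "dyadic_variation m (real k / 2^n) (1 / 2^n) (\<lambda>t. f t - t)
      = dyadic_variation m (real k / 2^n) (1 / 2^n) (\<lambda>t. g t - t)" for m k n :: nat
    by (intro dyadic_variation_cong) (simp_all add: eq)
  moreover have "f (real k / 2^n) = g (real k / 2^n)" for k n :: nat by (simp add: eq)
  ultimately show ?thesis unfolding creep_down_near_def by (simp only:)
qed

lemma jumps_over_shift:
  assumes eq: "\<And>t. 0 \<le> t \<Longrightarrow> w t = c + y t" and T: "0 \<le> T"
  shows "jumps_over T (c + a) w = jumps_over T a y"
proof -
  have "w (real k * (T / 2^n)) = c + y (real k * (T / 2^n))" for k n
    using T by (intro eq) simp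
  note * = this
  show ?thesis unfolding jumps_over_def * by (simp add: algebra_simps)
qed

section \<open>The law of the process with drift\<close>

context small_index_stable_process
begin

definition drift_path :: "real \<Rightarrow> 'a \<Rightarrow> real \<Rightarrow> real" where
  "drift_path x \<omega> = (\<lambda>t\<in>{0..}. x + Z t \<omega> + t)"

lemma drift_path_apply: "0 \<le> t \<Longrightarrow> drift_path x \<omega> t = x + Z t \<omega> + t"
  by (simp add: drift_path_def)

lemma cadlag_drift_path: "\<omega> \<in> space M \<Longrightarrow> cadlag (drift_path x \<omega>)"
  using cadlag_cong[OF cadlag_add_linear[OF cadlag_paths, of \<omega> x 1]] by (simp add: drift_path_apply)

lemma drift_path_measurable [measurable]: "drift_path x \<in> measurable M path_space"
  unfolding path_space_def
proof (rule measurable_restrict_space2)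
  show "drift_path x \<in> space M \<rightarrow> {w. cadlag w}" using cadlag_drift_path by auto
  show "drift_path x \<in> measurable M (PiM {0..} (\<lambda>_. borel))"
    unfolding drift_path_def by (intro measurable_restrict) simp
qed

lemma drift_law_eq: "drift_law M Z x = completion (distr M path_space (drift_path x))"
  by (simp add: drift_law_def drift_path_def[abs_def])

definition exceptional :: "real \<Rightarrow> (real \<Rightarrow> real) \<Rightarrow> bool" where
  "exceptional x w \<longleftrightarrow> w 0 \<noteq> x \<or> jump_near 0 w \<or> jump_near 1 w \<or> creep_down_near w"

lemma exceptional_measurable [measurable]: "Measurable.pred path_space (exceptional x)"
proof -
  have [measurable]: "(\<lambda>w. w 0) \<in> borel_measurable path_space"
    by (rule coordinate_measurable) simp
  show ?thesis unfolding exceptional_def by measurable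
qed

lemma AE_not_exceptional: "AE \<omega> in M. \<not> exceptional x (drift_path x \<omega>)"
  using AE_not_jump_near[of 0 x] AE_not_jump_near[of 1 x] AE_not_creep_down_near[of x] start_zero
proof eventually_elim
  case (elim \<omega>)
  have eq: "0 \<le> t \<Longrightarrow> drift_path x \<omega> t = x + Z t \<omega> + t" for t by (rule drift_path_apply)
  show ?case
    using elim jump_near_cong[of "drift_path x \<omega>" "\<lambda>t. x + Z t \<omega> + t", OF eq]
      creep_down_near_cong[of "drift_path x \<omega>" "\<lambda>t. x + Z t \<omega> + t", OF eq] eq[of 0]
    by (simp add: exceptional_def)
qed

lemma exceptional_null: "{w \<in> space path_space. exceptional x w} \<in> null_sets (distr M path_space (drift_path x))"
proof -
  have "AE w in distr M path_space (drift_path x). \<not> exceptional x w"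
    by (subst AE_distr_iff) (use AE_not_exceptional in auto)
  then show ?thesis by (subst (asm) AE_iff_null) auto
qed

lemma exits_at_0_null:
  assumes x: "x \<in> {0<..<1}"
  shows "emeasure (drift_law M Z x) (exits_at {0<..<1} 0) = 0"
proof -
  have sub: "exits_at {0<..<1} 0 \<subseteq> {w \<in> space path_space. exceptional x w}"
    using exits_at_0_imp_near x by (auto simp: exceptional_def exits_at_def)
  have null: "{w \<in> space path_space. exceptional x w} \<in> null_sets (drift_law M Z x)"
    unfolding drift_law_eq by (rule null_sets_completionI[OF exceptional_null])
  have "emeasure (drift_law M Z x) (exits_at {0<..<1} 0)
      \<le> emeasure (drift_law M Z x) {w \<in> space path_space. exceptional x w}"
    using sub null by (intro emeasure_mono) auto
  also have "\<dots> = 0" by (rule null_setsD1[OF null])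
  finally show ?thesis by (simp only: le_zero_eq)
qed

text \<open>
  Up to the null set of exceptional paths the exit event equals the event \<open>approaches_one\<close> of the
  coordinate \<open>\<sigma>\<close>-algebra, which makes it measurable for the completed law. Only then is its measure
  bounded below by that of an event on the underlying probability space: the measure of a
  nonmeasurable set is \<open>0\<close> by convention.
\<close>

lemma exits_at_1_positive:
  assumes x: "x \<in> {0<..<1}"
    and A: "A \<in> sets M" "0 < emeasure M A"
    and ex: "\<And>\<omega>. \<lbrakk>\<omega> \<in> A; \<not> exceptional x (drift_path x \<omega>)\<rbrakk> \<Longrightarrow> drift_path x \<omega> \<in> exits_at {0<..<1} 1"
  shows "0 < emeasure (drift_law M Z x) (exits_at {0<..<1} 1)"
proof -
  let ?\<mu> = "distr M path_space (drift_path x)"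
  let ?S = "{w \<in> space path_space. approaches_one w \<and> \<not> exceptional x w}"
  have S: "?S \<in> sets ?\<mu>" by simp
  have SE: "?S \<subseteq> exits_at {0<..<1} 1"
    using approaches_one_imp_exits_at_1 by (auto simp: exceptional_def)
  have ES: "exits_at {0<..<1} 1 \<subseteq> ?S \<union> {w \<in> space path_space. exceptional x w}"
    using exits_at_1_imp_approaches_one x by (auto simp: exceptional_def exits_at_def)
  have E: "exits_at {0<..<1} 1 \<in> sets (completion ?\<mu>)"
    by (rule sets_completionI[OF _ _ exceptional_null S, of _ "exits_at {0<..<1} 1 - ?S"]) (use SE ES in auto)
  have "emeasure M A = emeasure M {\<omega> \<in> space M. \<omega> \<in> A \<and> \<not> exceptional x (drift_path x \<omega>)}"
    using A(1) AE_not_exceptional[of x] sets.sets_into_space[OF A(1)] by (intro emeasure_eq_AE) auto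
  also have "\<dots> \<le> emeasure M (drift_path x -` ?S \<inter> space M)"
  proof (rule emeasure_mono)
    show "drift_path x -` ?S \<inter> space M \<in> sets M" by measurable
    show "{\<omega> \<in> space M. \<omega> \<in> A \<and> \<not> exceptional x (drift_path x \<omega>)} \<subseteq> drift_path x -` ?S \<inter> space M"
    proof
      fix \<omega> assume "\<omega> \<in> {\<omega> \<in> space M. \<omega> \<in> A \<and> \<not> exceptional x (drift_path x \<omega>)}"
      then have \<omega>: "\<omega> \<in> space M" "\<omega> \<in> A" "\<not> exceptional x (drift_path x \<omega>)" by auto
      have sp: "drift_path x \<omega> \<in> space path_space"
        by (rule measurable_space[OF drift_path_measurable \<omega>(1)])
      moreover have "approaches_one (drift_path x \<omega>)"
        using exits_at_1_imp_approaches_one[OF sp _ ex[OF \<omega>(2,3)]] \<omega>(3) x by (auto simp: exceptional_def)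
      ultimately show "\<omega> \<in> drift_path x -` ?S \<inter> space M" using \<omega> by simp
    qed
  qed
  also have "\<dots> = emeasure ?\<mu> ?S" by (rule emeasure_distr[symmetric]) (use S in auto)
  also have "\<dots> = emeasure (completion ?\<mu>) ?S" using S by simp
  also have "\<dots> \<le> emeasure (completion ?\<mu>) (exits_at {0<..<1} 1)"
    by (rule emeasure_mono[OF SE E])
  finally show ?thesis using A(2) by (simp add: drift_law_eq)
qed

text \<open>
  The good event. At time scale \<open>1 / 2 ^ j\<close> the factor \<open>1 / 4\<close> yields \<open>\<bar>Z t\<bar> \<le> t / 2\<close> for \<open>t\<close> in the upper half
  of \<open>[0, 1 / 2 ^ j]\<close>.
\<close>

definition small_variation :: "nat \<Rightarrow> 'a \<Rightarrow> bool" where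
  "small_variation J \<omega> \<longleftrightarrow> Z 0 \<omega> = 0 \<and>
     (\<forall>j\<ge>J. \<forall>m. dyadic_variation m 0 (1 / 2^j) (\<lambda>t. Z t \<omega>) \<le> 1 / 2^j / 4)"

lemma small_variation_measurable [measurable]: "Measurable.pred M (small_variation J)"
  unfolding small_variation_def by measurable

text \<open>
  The tail of the variation on an interval of length \<open>h\<close>, taken at a multiple of \<open>h\<close>, is of order
  \<open>h powr (1 - \<alpha>)\<close>, which is geometric in \<open>j\<close> for \<open>h = 1 / 2 ^ j\<close>.
\<close>

lemma large_variation_prob:
  fixes j :: nat
  shows "prob {\<omega> \<in> space M. \<exists>m. 1 / 2^j / 4 < dyadic_variation m 0 (1 / 2^j) (\<lambda>t. Z t \<omega>)}
    \<le> increment_const * 4 powr \<alpha> * (2 powr (\<alpha> - 1)) ^ j"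
proof -
  let ?V = "\<lambda>m \<omega>. dyadic_variation m 0 (1 / 2^j) (\<lambda>t. Z t \<omega>)"
  let ?h = "1 / 2^j :: real"
  have [measurable]: "?V m \<in> borel_measurable M" for m by (rule dyadic_variation_measurable) auto
  have "(\<exists>m. ?h / 4 < ?V m \<omega>) \<longleftrightarrow> (\<exists>m0. \<forall>m\<ge>m0. ?h / 4 < ?V m \<omega>)" for \<omega>
    by (rule ex_iff_eventually) (rule order_less_le_trans[OF _ dyadic_variation_mono])
  then have "prob {\<omega> \<in> space M. \<exists>m. ?h / 4 < ?V m \<omega>} = prob {\<omega> \<in> space M. \<exists>m0. \<forall>m\<ge>m0. ?h / 4 < ?V m \<omega>}"
    by (simp only:)
  also have "\<dots> \<le> increment_const * ?h * (?h / 4) powr - \<alpha>"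
  proof (rule prob_eventually_le)
    fix m
    have "prob {\<omega> \<in> space M. ?h / 4 < ?V m \<omega>} \<le> prob {\<omega> \<in> space M. ?h / 4 \<le> ?V m \<omega>}"
      by (intro finite_measure_mono) auto
    also have "\<dots> \<le> increment_const * ?h * (?h / 4) powr - \<alpha>"
      by (rule variation_tail) auto
    finally show "prob {\<omega> \<in> space M. ?h / 4 < ?V m \<omega>} \<le> increment_const * ?h * (?h / 4) powr - \<alpha>" .
  qed measurable
  also have "\<dots> = increment_const * 4 powr \<alpha> * (2 powr (\<alpha> - 1)) ^ j"
  proof -
    have quarter: "(h / 4) powr - \<alpha> = h powr - \<alpha> * 4 powr \<alpha>" if "0 < h" for h :: real
      using that by (simp add: powr_divide powr_minus field_simps)
    have "(?h / 4) powr - \<alpha> = ?h powr - \<alpha> * 4 powr \<alpha>" by (rule quarter) simp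
    moreover have "?h * ?h powr - \<alpha> = ?h powr (1 + - \<alpha>)" by (rule powr_mult_base) simp
    then have "?h * ?h powr - \<alpha> = ?h powr (1 - \<alpha>)" by (simp only: add_uminus_conv_diff)
    moreover have "?h powr (1 - \<alpha>) = (2 powr (\<alpha> - 1)) ^ j"
    proof -
      have h: "?h = 2 powr - real j" by (simp add: powr_minus powr_realpow divide_inverse)
      have "?h powr (1 - \<alpha>) = 2 powr (- real j * (1 - \<alpha>))" unfolding h by (rule powr_powr)
      also have "\<dots> = (2 powr (\<alpha> - 1)) powr real j" by (simp add: powr_powr algebra_simps)
      also have "\<dots> = (2 powr (\<alpha> - 1)) ^ j" by (simp add: powr_realpow)
      finally show ?thesis .
    qed
    moreover have "increment_const * ?h * (A * 4 powr \<alpha>) = increment_const * 4 powr \<alpha> * (?h * A)" for A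
      by (simp only: mult_ac)
    ultimately show ?thesis by (simp only:)
  qed
  finally show ?thesis .
qed

lemma ex_small_variation: "\<exists>J\<ge>2. 1 / 2 \<le> prob {\<omega> \<in> space M. small_variation J \<omega>}"
proof -
  let ?p = "2 powr (\<alpha> - 1)" and ?C = "increment_const * 4 powr \<alpha>"
  have p: "0 < ?p" "?p < 1" using alpha_less_1 powr_less_mono[of "\<alpha> - 1" 0 2] by auto
  have C: "0 \<le> ?C" using increment_const_nonneg by simp
  have "0 < (1 - ?p) / (2 * (?C + 1))" using p C by (intro divide_pos_pos) auto
  then obtain J0 where J0: "?p ^ J0 < (1 - ?p) / (2 * (?C + 1))" using real_arch_pow_inv p by blast
  define J where "J = max J0 2"
  \<comment> \<open>\<open>J\<close> makes the tail of the geometric series at most \<open>1 / 2\<close>; \<open>J \<ge> 2\<close> gives \<open>1 / 2 ^ J \<le> 1 / 4\<close>.\<close>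
  have "?p ^ J \<le> ?p ^ J0" using p by (intro power_decreasing) (auto simp: J_def)
  then have "?p ^ J < (1 - ?p) / (2 * (?C + 1))" using J0 by (rule order_le_less_trans)
  moreover have "0 < 2 * (?C + 1)" using C by simp
  ultimately have "?p ^ J * (2 * (?C + 1)) \<le> 1 - ?p" by (simp only: pos_less_divide_eq less_imp_le)
  moreover have "2 * (?C * ?p ^ J) \<le> ?p ^ J * (2 * (?C + 1))" using p by (simp add: algebra_simps)
  ultimately have "2 * (?C * ?p ^ J) \<le> 1 - ?p" by (rule order_trans[rotated])
  then have small: "?C * ?p ^ J / (1 - ?p) \<le> 1 / 2"
  proof -
    have "X / D \<le> 1 / 2" if "2 * X \<le> D" "0 < D" for X D :: real using that by (simp add: field_simps)
    then show ?thesis using \<open>2 * (?C * ?p ^ J) \<le> 1 - ?p\<close> p by simp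
  qed
  let ?B = "\<lambda>j. {\<omega> \<in> space M. \<exists>m. 1 / 2^(j + J) / 4 < dyadic_variation m 0 (1 / 2^(j + J)) (\<lambda>t. Z t \<omega>)}"
  have [measurable]: "(\<lambda>\<omega>. dyadic_variation m 0 (1 / 2^j) (\<lambda>t. Z t \<omega>)) \<in> borel_measurable M" for m j :: nat
    by (rule dyadic_variation_measurable) auto
  have B: "prob (?B j) \<le> ?C * ?p ^ J * ?p ^ j" for j
    using large_variation_prob[of "j + J"] by (simp add: power_add mult_ac)
  have sums: "(\<lambda>j. ?C * ?p ^ J * ?p ^ j) sums (?C * ?p ^ J * (1 / (1 - ?p)))"
    using p by (intro sums_mult geometric_sums) auto
  have summ: "summable (\<lambda>j. prob (?B j))"
    by (rule summable_comparison_test'[OF sums_summable[OF sums], of 0]) (use B in auto)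
  have "prob (\<Union>j. ?B j) \<le> (\<Sum>j. prob (?B j))"
    by (rule finite_measure_subadditive_countably[OF _ summ]) auto
  also have "\<dots> \<le> (\<Sum>j. ?C * ?p ^ J * ?p ^ j)"
    by (intro suminf_le summ sums_summable[OF sums]) (rule B)
  also have "\<dots> \<le> 1 / 2" using sums small by (simp add: sums_iff)
  finally have U: "prob (\<Union>j. ?B j) \<le> 1 / 2" .
  have "1 / 2 \<le> prob (space M - (\<Union>j. ?B j))"
    by (subst prob_compl) (use U in auto)
  also have "\<dots> \<le> prob {\<omega> \<in> space M. small_variation J \<omega>}"
  proof (rule finite_measure_mono_AE)
    show "AE \<omega> in M. \<omega> \<in> space M - (\<Union>j. ?B j) \<longrightarrow> \<omega> \<in> {\<omega> \<in> space M. small_variation J \<omega>}"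
      using start_zero
    proof eventually_elim
      case (elim \<omega>)
      show ?case
      proof
        assume \<omega>: "\<omega> \<in> space M - (\<Union>j. ?B j)"
        have "dyadic_variation m 0 (1 / 2^j) (\<lambda>t. Z t \<omega>) \<le> 1 / 2^j / 4" if "J \<le> j" for j m
        proof -
          have j: "j - J + J = j" using that by simp
          have "\<omega> \<in> space M" "\<omega> \<notin> ?B (j - J)" using \<omega> by blast+
          then show ?thesis unfolding j by (simp only: mem_Collect_eq not_ex not_less simp_thms)
        qed
        then show "\<omega> \<in> {\<omega> \<in> space M. small_variation J \<omega>}" using \<omega> elim by (simp add: small_variation_def)
      qed
    qed
  qed measurable
  finally show ?thesis by (intro exI[of _ J]) (simp add: J_def)
qed

lemma small_variation_bounds:
  assumes \<omega>: "\<omega> \<in> space M" and sv: "small_variation J \<omega>" and t: "0 \<le> t" "t \<le> 1 / 2^J"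
  shows "\<bar>Z t \<omega>\<bar> \<le> t / 2" and "\<bar>Z t \<omega>\<bar> \<le> 1 / 2^J / 4"
proof -
  have bound: "\<bar>Z t \<omega>\<bar> \<le> 1 / 2^j / 4" if "J \<le> j" "t \<le> 1 / 2^j" for j
  proof (rule ccontr)
    assume "\<not> ?thesis"
    then have "\<exists>m. 1 / 2^j / 4 < dyadic_variation m 0 (1 / 2^j) (\<lambda>t. Z t \<omega>)"
      using sv t that by (intro dyadic_variation_exceeds[OF cadlag_paths[OF \<omega>], of 0 t])
        (auto simp: small_variation_def)
    then show False using sv that(1) by (auto simp: small_variation_def not_le[symmetric])
  qed
  from bound[OF order_refl t(2)] show "\<bar>Z t \<omega>\<bar> \<le> 1 / 2^J / 4" .
  show "\<bar>Z t \<omega>\<bar> \<le> t / 2"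
  proof (cases "t = 0")
    case True
    then show ?thesis using sv by (simp add: small_variation_def)
  next
    case False
    then have "0 < t" using t by simp
    then obtain n0 where "1 / 2^n0 < t" using ex_small_power by blast
    then have ex: "\<exists>n. 1 / 2^n < t" ..
    \<comment> \<open>The scale \<open>j\<close> with \<open>1 / 2 ^ Suc j < t \<le> 1 / 2 ^ j\<close>, where \<open>n = Suc j\<close>.\<close>
    define n where "n = (LEAST n. 1 / 2^n < t)"
    have n: "1 / 2^n < t" unfolding n_def by (rule LeastI_ex[OF ex])
    have "J < n"
    proof (rule ccontr)
      assume "\<not> J < n"
      then have "1 / 2^J \<le> (1 / 2^n :: real)" by (intro divide_left_mono power_increasing) auto
      then show False using n t(2) by linarith
    qed
    then obtain j where j: "n = Suc j" "J \<le> j" by (cases n) auto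
    have "t \<le> 1 / 2^j" using not_less_Least[of j "\<lambda>n. 1 / 2^n < t"] j(1) n_def by auto
    from bound[OF j(2) this] have "\<bar>Z t \<omega>\<bar> \<le> 1 / 2^n / 2" by (simp add: j(1))
    also have "1 / 2^n / 2 \<le> t / 2" using n by (intro divide_right_mono) auto
    finally show ?thesis .
  qed
qed

end

section \<open>The three assertions\<close>

context small_index_stable_process
begin

text \<open>
  On the good event the path satisfies \<open>x \<le> w t \<le> 3 / 4\<close> before time \<open>1 / 2 ^ J\<close>. Requiring this at
  rational times gives a measurable event, and the indicator function of that event provides a
  measurable minorant of the exit time.
\<close>

lemma exit_time_lower_bound:
  assumes x: "x \<in> {0<..<1/4}" and J: "2 \<le> J"
  shows "ennreal (1 / 2^J) * emeasure M {\<omega> \<in> space M. small_variation J \<omega>}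
    \<le> (\<integral>\<^sup>+ w. exit_time {0<..<1} w \<partial>drift_law M Z x)"
proof -
  define T where "T = (1 / 2^J :: real)"
  let ?\<mu> = "distr M path_space (drift_path x)"
  let ?H = "{w \<in> space path_space. \<forall>r::rat. 0 \<le> r \<longrightarrow> real_of_rat r < T \<longrightarrow>
     x \<le> w (real_of_rat r) \<and> w (real_of_rat r) \<le> 3 / 4}"
  have T: "T \<le> 1 / 4"
    unfolding T_def using power_increasing[OF J, of "2::real"] by (simp add: field_simps)
  have 2: "Measurable.pred N (\<lambda>w. c \<le> f w \<and> f w \<le> d)" if [measurable]: "f \<in> borel_measurable N"
    for f :: "'b \<Rightarrow> real" and N c d
    by measurable
  have "Measurable.pred path_space (\<lambda>w. \<forall>r::rat. 0 \<le> r \<longrightarrow> real_of_rat r < T \<longrightarrow>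
     x \<le> w (real_of_rat r) \<and> w (real_of_rat r) \<le> 3 / 4)"
    by (intro pred_intros_countable pred_intros_imp' 2 coordinate_measurable) simp
  then have H: "?H \<in> sets ?\<mu>" unfolding pred_def sets_distr .
  have late: "ennreal T \<le> exit_time {0<..<1} w" if w: "w \<in> ?H" for w
    unfolding exit_time_def
  proof (rule INF_greatest)
    fix t assume t: "t \<in> {t. 0 \<le> t \<and> w t \<notin> {0<..<1}}"
    have "\<not> t < T"
    proof
      assume "t < T"
      then have "x \<le> w t \<and> w t \<le> 3 / 4"
        using w t by (intro cadlag_bounds_from_rationals[of w t T] space_path_space_cadlag) auto
      then show False using t x by auto
    qed
    then show "ennreal T \<le> ennreal t" by (intro ennreal_leI) simp
  qed
  have "emeasure M {\<omega> \<in> space M. small_variation J \<omega>} \<le> emeasure M (drift_path x -` ?H \<inter> space M)"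
  proof (rule emeasure_mono)
    show "drift_path x -` ?H \<inter> space M \<in> sets M"
      by (rule measurable_sets[OF drift_path_measurable H[unfolded sets_distr]])
    show "{\<omega> \<in> space M. small_variation J \<omega>} \<subseteq> drift_path x -` ?H \<inter> space M"
    proof
      fix \<omega> assume "\<omega> \<in> {\<omega> \<in> space M. small_variation J \<omega>}"
      then have \<omega>: "\<omega> \<in> space M" "small_variation J \<omega>" by auto
      have "x \<le> drift_path x \<omega> t \<and> drift_path x \<omega> t \<le> 3 / 4" if t: "0 \<le> t" "t < T" for t
      proof -
        have "\<bar>Z t \<omega>\<bar> \<le> t / 2" using t by (intro small_variation_bounds(1)[OF \<omega>]) (auto simp: T_def)
        then have "- t \<le> Z t \<omega>" "Z t \<omega> \<le> t" using t(1) by auto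
        then show ?thesis using t T x by (simp add: drift_path_apply)
      qed
      then have "drift_path x \<omega> \<in> ?H"
        using measurable_space[OF drift_path_measurable \<omega>(1)] by (intro CollectI conjI allI impI) simp_all
      then show "\<omega> \<in> drift_path x -` ?H \<inter> space M" using \<omega>(1) by (intro IntI vimageI2)
    qed
  qed
  also have "\<dots> = emeasure ?\<mu> ?H"
    by (rule emeasure_distr[OF drift_path_measurable H[unfolded sets_distr], symmetric])
  also have "\<dots> = emeasure (completion ?\<mu>) ?H"
    by (simp only: emeasure_completion[OF sets_completionI_sets[OF H]] main_part[OF H])
  finally have "ennreal T * emeasure M {\<omega> \<in> space M. small_variation J \<omega>}
      \<le> ennreal T * emeasure (completion ?\<mu>) ?H" by (rule mult_left_mono) simp
  also have "\<dots> = (\<integral>\<^sup>+ w. ennreal T * indicator ?H w \<partial>completion ?\<mu>)"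
    by (rule nn_integral_cmult_indicator[symmetric]) (rule sets_completionI_sets[OF H])
  also have "\<dots> \<le> (\<integral>\<^sup>+ w. exit_time {0<..<1} w \<partial>completion ?\<mu>)"
  proof (rule nn_integral_mono)
    fix w
    show "ennreal T * indicator ?H w \<le> exit_time {0<..<1} w"
    proof (cases "w \<in> ?H")
      case True
      then show ?thesis using late[OF True] by (simp only: indicator_simps mult_1_right)
    next
      case False
      show ?thesis unfolding indicator_simps(2)[OF False] mult_zero_right by (rule zero_le)
    qed
  qed
  finally show ?thesis unfolding drift_law_eq T_def .
qed

text \<open>
  The levels crossed in a cell form an interval of length at most twice the increment of \<open>Z\<close> over that
  cell. Summed over a grid these lengths are at most twice the variation of \<open>Z\<close>, for every grid, and
  so is the measure of the set of levels that are crossed on all fine grids.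
\<close>

lemma levels_jumped_over:
  assumes \<omega>: "\<omega> \<in> space M" and sv: "small_variation J \<omega>"
  shows "emeasure lborel {a. jumps_over (1 / 2^J) a (\<lambda>t. Z t \<omega> + t)} \<le> ennreal (1 / 2^J / 2)"
proof -
  define T where "T = (1 / 2^J :: real)"
  define Y where "Y n k = Z (real k * (T / 2^n)) \<omega> + real k * (T / 2^n)" for n k
  define d where "d n k = \<bar>Z (real (Suc k) * (T / 2^n)) \<omega> - Z (real k * (T / 2^n)) \<omega>\<bar>" for n k
  define P where "P n k a \<longleftrightarrow> Y n k < a \<and> a < Y n (Suc k) \<and> T / 2^n \<le> \<bar>Y n (Suc k) - Y n k - T / 2^n\<bar>" for n k a
  have step: "emeasure lborel {a. P n k a} \<le> ennreal (2 * d n k)" for n k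
  proof -
    have "real (Suc k) * (T / 2^n) = real k * (T / 2^n) + T / 2^n" by (simp add: field_simps)
    then have inc: "\<bar>Y n (Suc k) - Y n k - T / 2^n\<bar> = d n k"
      unfolding Y_def d_def by (intro arg_cong[where f=abs]) linarith
    show ?thesis
    proof (cases "Y n k < Y n (Suc k) \<and> T / 2^n \<le> d n k")
      case True
      have "emeasure lborel {a. P n k a} \<le> emeasure lborel {Y n k<..<Y n (Suc k)}"
        by (intro emeasure_mono) (auto simp: P_def)
      also have "\<dots> = ennreal (Y n (Suc k) - Y n k)" using True by (intro emeasure_lborel_Ioo) auto
      also have "\<dots> \<le> ennreal (2 * d n k)"
      proof (rule ennreal_leI)
        show "Y n (Suc k) - Y n k \<le> 2 * d n k" using inc True by linarith
      qed
      finally show ?thesis .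
    next
      case False
      then have "{a. P n k a} = {}" unfolding P_def inc by auto
      then show ?thesis by (simp only: emeasure_empty zero_le)
    qed
  qed
  have bound: "emeasure lborel {a \<in> space lborel. \<exists>k<(2::nat)^n. P n k a} \<le> ennreal (T / 2)" for n
  proof -
    have "{a \<in> space lborel. \<exists>k<(2::nat)^n. P n k a} = (\<Union>k\<in>{..<2^n}. {a. P n k a})" by auto
    also have "emeasure lborel \<dots> \<le> (\<Sum>k\<in>{..<2^n}. emeasure lborel {a. P n k a})"
    proof (rule emeasure_subadditive_finite)
      have "{a. c < a \<and> a < d \<and> e} \<in> sets lborel" for c d :: real and e
      proof -
        have "{a. c < a \<and> a < d \<and> e} = (if e then {c<..<d} else {})" by auto
        then show ?thesis by simp
      qed
      then show "(\<lambda>k. {a. P n k a}) ` {..<2^n} \<subseteq> sets lborel" unfolding P_def by (intro image_subsetI)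
    qed simp
    also have "\<dots> \<le> (\<Sum>k\<in>{..<2^n}. ennreal (2 * d n k))"
      by (rule sum_mono) (rule step)
    also have "\<dots> = ennreal (\<Sum>k<2^n. 2 * d n k)" by (rule sum_ennreal) (simp add: d_def)
    also have "(\<Sum>k<2^n. 2 * d n k) = 2 * (\<Sum>k<2^n. d n k)" by (rule sum_distrib_left[symmetric])
    also have "(\<Sum>k<2^n. d n k) = dyadic_variation n 0 T (\<lambda>t. Z t \<omega>)"
      unfolding dyadic_variation_def d_def by (simp only: add_0_left times_divide_eq_right)
    also have "ennreal (2 * dyadic_variation n 0 T (\<lambda>t. Z t \<omega>)) \<le> ennreal (T / 2)"
    proof (rule ennreal_leI)
      have "dyadic_variation n 0 T (\<lambda>t. Z t \<omega>) \<le> T / 4" using sv by (simp add: small_variation_def T_def)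
      then show "2 * dyadic_variation n 0 T (\<lambda>t. Z t \<omega>) \<le> T / 2" by simp
    qed
    finally show ?thesis .
  qed
  have "{a. jumps_over T a (\<lambda>t. Z t \<omega> + t)} = {a \<in> space lborel. \<exists>n0. \<forall>n\<ge>n0. \<exists>k<(2::nat)^n. P n k a}"
    unfolding jumps_over_def P_def Y_def by simp
  also have "emeasure lborel \<dots> \<le> ennreal (T / 2)"
  proof (rule emeasure_eventually_le[OF _ bound])
    have "Measurable.pred lborel (\<lambda>a. c < a \<and> a < d \<and> e)" for c d :: real and e by measurable
    then show "Measurable.pred lborel (\<lambda>a. \<exists>k<(2::nat)^n. P n k a)" for n
      unfolding P_def by (intro pred_intros_countable pred_intros_conj1')
  qed
  finally show ?thesis unfolding T_def .
qed

text \<open>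
  For every good \<open>\<omega>\<close> the levels in \<open>(0, 3T/4)\<close> that are not jumped over have measure at least
  \<open>3T/4 - T/2 = T/4\<close>. By Fubini their probability cannot vanish for all levels at once.
\<close>

lemma ex_level_not_jumped_over:
  assumes pos: "0 < prob {\<omega> \<in> space M. small_variation J \<omega>}"
  shows "\<exists>a. 0 < a \<and> a < 3 / 4 * (1 / 2^J) \<and>
    {\<omega> \<in> space M. small_variation J \<omega> \<and> \<not> jumps_over (1 / 2^J) a (\<lambda>t. Z t \<omega> + t)} \<in> sets M \<and>
    0 < emeasure M {\<omega> \<in> space M. small_variation J \<omega> \<and> \<not> jumps_over (1 / 2^J) a (\<lambda>t. Z t \<omega> + t)}"
proof (rule ccontr)
  define T where "T = (1 / 2^J :: real)"
  have T: "0 < T" by (simp add: T_def)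
  let ?G = "{\<omega> \<in> space M. small_variation J \<omega>}"
  let ?E = "\<lambda>a. {\<omega> \<in> space M. small_variation J \<omega> \<and> \<not> jumps_over T a (\<lambda>t. Z t \<omega> + t)}"
  interpret L: pair_sigma_finite lborel M ..
  have Zs: "(\<lambda>p. Z (real k * (T / 2^n)) (snd p)) \<in> borel_measurable (lborel \<Otimes>\<^sub>M M)" for k n
    by (rule measurable_compose[OF measurable_snd random_variable_Z]) (simp add: T_def)
  note Zs[measurable]
  have "Measurable.pred (lborel \<Otimes>\<^sub>M M) (\<lambda>p. jumps_over T (fst p) (\<lambda>t. Z t (snd p) + t))"
    unfolding jumps_over_def by measurable
  note this[measurable]
  let ?S = "{p \<in> space (lborel \<Otimes>\<^sub>M M). fst p \<in> {0<..<3 / 4 * T} \<and> small_variation J (snd p) \<and>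
     \<not> jumps_over T (fst p) (\<lambda>t. Z t (snd p) + t)}"
  have S: "?S \<in> sets (lborel \<Otimes>\<^sub>M M)" by measurable
  have slice: "Pair a -` ?S = (if a \<in> {0<..<3 / 4 * T} then ?E a else {})" for a
    by (auto simp: space_pair_measure)
  have E: "?E a \<in> sets M" if "a \<in> {0<..<3 / 4 * T}" for a
    using sets_Pair1[OF S, of a] that unfolding slice by simp
  assume none: "\<not> ?thesis"
  have "emeasure M (Pair a -` ?S) = 0" for a
  proof (cases "a \<in> {0<..<3 / 4 * T}")
    case True
    then have "0 < a" "a < 3 / 4 * T" by (simp_all only: greaterThanLessThan_iff)
    then have "\<not> 0 < emeasure M (?E a)" using none[folded T_def] E[OF True] by blast
    then show ?thesis unfolding slice if_P[OF True] by (simp only: zero_less_iff_neq_zero not_not)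
  next
    case False
    show ?thesis unfolding slice if_not_P[OF False] by (rule emeasure_empty)
  qed
  then have "(\<integral>\<^sup>+a. emeasure M (Pair a -` ?S) \<partial>lborel) = 0" by (simp only: nn_integral_const mult_zero_left)
  then have "emeasure (lborel \<Otimes>\<^sub>M M) ?S = 0"
    by (simp only: emeasure_pair_measure_alt[OF S])
  moreover have "ennreal (T / 4) * emeasure M ?G \<le> emeasure (lborel \<Otimes>\<^sub>M M) ?S"
  proof -
    have "ennreal (T / 4) * emeasure M ?G = (\<integral>\<^sup>+\<omega>. ennreal (T / 4) * indicator ?G \<omega> \<partial>M)"
      by (rule nn_integral_cmult_indicator[symmetric]) measurable
    also have "\<dots> \<le> (\<integral>\<^sup>+\<omega>. emeasure lborel ((\<lambda>a. (a, \<omega>)) -` ?S) \<partial>M)"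
    proof (rule nn_integral_mono)
      fix \<omega> assume \<omega>: "\<omega> \<in> space M"
      show "ennreal (T / 4) * indicator ?G \<omega> \<le> emeasure lborel ((\<lambda>a. (a, \<omega>)) -` ?S)"
      proof (cases "small_variation J \<omega>")
        case True
        let ?A = "(\<lambda>a. (a, \<omega>)) -` ?S" and ?B = "{a. jumps_over T a (\<lambda>t. Z t \<omega> + t)}"
        have A: "?A \<in> sets lborel" by (rule sets_Pair2[OF S])
        have B: "?B \<in> sets lborel"
        proof -
          have "(\<lambda>a. (a, \<omega>)) \<in> measurable lborel (lborel \<Otimes>\<^sub>M M)" using \<omega> by simp
          then have "Measurable.pred lborel (\<lambda>a. jumps_over T (fst (a, \<omega>)) (\<lambda>t. Z t (snd (a, \<omega>)) + t))"
            by (rule measurable_compose) measurable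
          then show ?thesis by (simp add: pred_def)
        qed
        have "ennreal (3 / 4 * T) = emeasure lborel {0<..<3 / 4 * T}" using T by simp
        also have "\<dots> \<le> emeasure lborel (?A \<union> ?B)"
          using \<omega> True A B by (intro emeasure_mono) (auto simp: space_pair_measure)
        also have "\<dots> \<le> emeasure lborel ?A + emeasure lborel ?B"
          by (rule emeasure_subadditive[OF A B])
        also have "\<dots> \<le> emeasure lborel ?A + ennreal (T / 2)"
          by (intro add_left_mono levels_jumped_over[OF \<omega> True, folded T_def])
        finally have "ennreal (3 / 4 * T) - ennreal (T / 2) \<le> emeasure lborel ?A"
          by (simp add: ennreal_minus_le_iff add.commute)
        moreover have "ennreal (3 / 4 * T) - ennreal (T / 2) = ennreal (T / 4)"
          using T by (subst ennreal_minus) (auto simp: field_simps)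
        moreover have "indicator ?G \<omega> = (1 :: ennreal)" using \<omega> True by simp
        ultimately show ?thesis by (simp only: mult_1_right)
      qed (simp add: indicator_def)
    qed
    also have "\<dots> = emeasure (lborel \<Otimes>\<^sub>M M) ?S" by (rule L.emeasure_pair_measure_alt2[OF S, symmetric])
    finally show ?thesis .
  qed
  ultimately have "ennreal (T / 4) * emeasure M ?G = 0" by simp
  then show False using pos T by (simp add: emeasure_eq_measure)
qed

text \<open>
  At time \<open>T = 1 / 2 ^ J\<close> the path started from \<open>1 - a\<close> has reached at least \<open>1 - a + 3T/4 > 1\<close> without having
  come down to \<open>0\<close>, and it has not jumped over \<open>1\<close>, so it has passed \<open>1\<close> continuously.
\<close>

lemma ex_creeping_start: "\<exists>x\<in>{0<..<1}. 0 < emeasure (drift_law M Z x) (exits_at {0<..<1} 1)"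
proof -
  obtain J where J: "2 \<le> J" "1 / 2 \<le> prob {\<omega> \<in> space M. small_variation J \<omega>}"
    using ex_small_variation by blast
  let ?T = "1 / 2^J :: real"
  have T: "0 < ?T" "?T \<le> 1 / 4"
    using power_increasing[OF J(1), of "2::real"] by (simp_all add: field_simps)
  have "0 < prob {\<omega> \<in> space M. small_variation J \<omega>}" using J(2) by linarith
  from ex_level_not_jumped_over[OF this] obtain a where a: "0 < a" "a < 3 / 4 * ?T"
    and A: "{\<omega> \<in> space M. small_variation J \<omega> \<and> \<not> jumps_over ?T a (\<lambda>t. Z t \<omega> + t)} \<in> sets M"
      "0 < emeasure M {\<omega> \<in> space M. small_variation J \<omega> \<and> \<not> jumps_over ?T a (\<lambda>t. Z t \<omega> + t)}" by blast
  have "a < 1" using a(2) T(2) by linarith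
  then have x: "1 - a \<in> {0<..<1}" using a(1) by simp
  have "0 < emeasure (drift_law M Z (1 - a)) (exits_at {0<..<1} 1)"
  proof (rule exits_at_1_positive[OF x A])
    fix \<omega>
    assume "\<omega> \<in> {\<omega> \<in> space M. small_variation J \<omega> \<and> \<not> jumps_over ?T a (\<lambda>t. Z t \<omega> + t)}"
      and ne: "\<not> exceptional (1 - a) (drift_path (1 - a) \<omega>)"
    then have \<omega>: "\<omega> \<in> space M" "small_variation J \<omega>" "\<not> jumps_over ?T a (\<lambda>t. Z t \<omega> + t)" by auto
    let ?w = "drift_path (1 - a) \<omega>"
    have w: "?w t = (1 - a) + (Z t \<omega> + t)" if "0 \<le> t" for t using that by (simp add: drift_path_apply)
    show "?w \<in> exits_at {0<..<1} 1"
    proof (rule exits_at_1_of_no_jump)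
      show "?w \<in> space path_space" by (rule measurable_space[OF drift_path_measurable \<omega>(1)])
      show "?w 0 < 1" using w[of 0] \<omega>(2) a by (simp add: small_variation_def)
      show "0 \<le> ?T" by simp
      have "\<bar>Z ?T \<omega>\<bar> \<le> ?T / 4" using T by (intro small_variation_bounds(2)[OF \<omega>(1,2)]) auto
      then have "- (?T / 4) \<le> Z ?T \<omega>" by linarith
      then show "1 \<le> ?w ?T" using w[of ?T] a(2) by simp
      show "0 < ?w t" if t: "0 \<le> t" "t \<le> ?T" for t
      proof -
        have "\<bar>Z t \<omega>\<bar> \<le> t / 2" by (rule small_variation_bounds(1)[OF \<omega>(1,2) t])
        then have "- t \<le> Z t \<omega>" using t(1) by linarith
        then show ?thesis using w[OF t(1)] x by simp
      qed
      show "\<not> jumps_over ?T 1 ?w"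
        using jumps_over_shift[of ?w "1 - a" "\<lambda>t. Z t \<omega> + t" ?T a] w \<omega>(3) T by simp
      show "\<not> jump_near 1 ?w" using ne by (simp add: exceptional_def)
    qed
  qed
  then show ?thesis using x by blast
qed

end

theorem proposition8p1:
  fixes M :: "'a measure" and \<alpha> :: real and Z :: "real \<Rightarrow> 'a \<Rightarrow> real"
  assumes "0 < \<alpha>" and "\<alpha> < 1"
    and "symmetric_stable_process M \<alpha> Z"
  shows "(INF x\<in>{0<..<1/4}. \<integral>\<^sup>+ w. exit_time {0<..<1} w \<partial>drift_law M Z x) > 0 \<and>
         (SUP x\<in>{0<..<1}. emeasure (drift_law M Z x) (exits_at {0<..<1} 0)) = 0 \<and>
         (SUP x\<in>{0<..<1}. emeasure (drift_law M Z x) (exits_at {0<..<1} 1)) > 0"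
proof (intro conjI)
  interpret symmetric_stable_process M \<alpha> Z by fact
  interpret small_index_stable_process M \<alpha> Z by unfold_locales fact+
  obtain J where J: "2 \<le> J" "1 / 2 \<le> prob {\<omega> \<in> space M. small_variation J \<omega>}"
    using ex_small_variation by blast
  have "0 < ennreal (1 / 2^J) * emeasure M {\<omega> \<in> space M. small_variation J \<omega>}"
    using J(2) by (simp add: emeasure_eq_measure ennreal_zero_less_mult_iff)
  also have "\<dots> \<le> (INF x\<in>{0<..<1/4}. \<integral>\<^sup>+ w. exit_time {0<..<1} w \<partial>drift_law M Z x)"
    by (rule INF_greatest) (rule exit_time_lower_bound[OF _ J(1)])
  finally show "(INF x\<in>{0<..<1/4}. \<integral>\<^sup>+ w. exit_time {0<..<1} w \<partial>drift_law M Z x) > 0" .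
  show "(SUP x\<in>{0<..<1}. emeasure (drift_law M Z x) (exits_at {0<..<1} 0)) = 0"
    using exits_at_0_null by (simp cong: SUP_cong_simp)
  show "(SUP x\<in>{0<..<1}. emeasure (drift_law M Z x) (exits_at {0<..<1} 1)) > 0"
    using ex_creeping_start by (auto simp: less_SUP_iff)
qed

end
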